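(* Let $(X_1,Y_1),\ldots,(X_n,Y_n)$, $n\ge 2$, be i.i.d. copies of a random pair $(X,Y)$ with distribution $P$ on $\mathcal{X}\times\mathbb{R}$, where $Y$ is square integrable. Let $\varphi_1,\ldots,\varphi_d:\mathcal{X}\to\mathbb{R}$ be square integrable functions (with respect to the law of $X$), $\varphi(x)=(\varphi_1(x),\ldots,\varphi_d(x))^T$, and for $\theta\in\mathbb{R}^d$ let $f_\theta(x)=\langle\theta,\varphi(x)\rangle$. Let $\Theta\subseteq\mathbb{R}^d$ be a closed convex set (possibly $\Theta=\mathbb{R}^d$) and $\lambda\ge 0$. Let $R(f)=\mathbb{E}\{[Y-f(X)]^2\}$, $r(f)=\frac1n\sum_{i=1}^n[f(X_i)-Y_i]^2$, let $\hat\theta^{(\mathrm{ridge})}\in\arg\min_{\theta\in\Theta}\{r(f_\theta)+\lambda\|\theta\|^2\}$ and $\hat f^{(\mathrm{ridge})}=f_{\hat\theta^{(\mathrm{ridge})}}$, and let $\tilde\theta\in\arg\min_{\theta\in\Theta}\{R(f_\theta)+\lambda\|\theta\|^2\}$ and $\tilde f=f_{\tilde\theta}$. Assume $$\mathbb{E}[\|\varphi(X)\|^4]<+\infty\quad\text{and}\quad\mathbb{E}\{\|\varphi(X)\|^2[\tilde f(X)-Y]^2\}<+\infty.$$ Let $Q=\mathbb{E}[\varphi(X)\varphi(X)^T]$ with eigenvalues $\nu_1\ge\cdots\ge\nu_d$, let $Q_\lambda=Q+\lambda I$, and define the effective ridge dimension $$D=\sum_{i=1}^d\frac{\nu_i}{\nu_i+\lambda}\mathbb{1}(\nu_i>0)=\mathbb{E}[\|Q_\lambda^{-1/2}\varphi(X)\|^2].$$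 Then for any $\varepsilon>0$ there exists $n_\varepsilon$ such that for any $n\ge n_\varepsilon$, with probability at least $1-\varepsilon$, $$R(\hat f^{(\mathrm{ridge})})+\lambda\|\hat\theta^{(\mathrm{ridge})}\|^2\le\min_{\theta\in\Theta}\{R(f_\theta)+\lambda\|\theta\|^2\}+\frac{30\,\mathbb{E}\{\|Q_\lambda^{-1/2}\varphi(X)\|^2[\tilde f(X)-Y]^2\}}{\mathbb{E}\{\|Q_\lambda^{-1/2}\varphi(X)\|^2\}}\frac{D}{n}+1000\sup_{v\in\mathbb{R}^d}\frac{\mathbb{E}[\langle v,\varphi(X)\rangle^2[\tilde f(X)-Y]^2]}{\mathbb{E}(\langle v,\varphi(X)\rangle^2)+\lambda\|v\|^2}\frac{\log(3\varepsilon^{-1})}{n}$$ $$\le\min_{\theta\in\Theta}\{R(f_\theta)+\lambda\|\theta\|^2\}+\operatorname{ess\,sup}\mathbb{E}\{[Y-\tilde f(X)]^2\mid X\}\,\frac{30D+1000\log(3\varepsilon^{-1})}{n}.$$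
   Context: $\|\cdot\|$ and $\langle\cdot,\cdot\rangle$ denote the Euclidean norm and inner product on $\mathbb{R}^d$; $I$ is the $d\times d$ identity matrix. When $\lambda=0$, $D$ equals the rank of $Q$. *)

theory Defs
  imports "HOL-Probability.Probability" "HOL-Computational_Algebra.Polynomial"
begin

definition charpoly_mat :: "real^'n^'n \<Rightarrow> real poly" where
  "charpoly_mat A = det (\<chi> i j. (if i = j then [:0, 1:] else 0) - [:A $ i $ j:])"

definition eigenvalues_mset :: "real^'n^'n \<Rightarrow> real multiset" where
  "eigenvalues_mset A = proots (charpoly_mat A)"

definition pinv_mat :: "real^'n^'n \<Rightarrow> real^'n^'n" where
  "pinv_mat A = (THE B. A ** B ** A = A \<and> B ** A ** B = B \<and>
                    transpose (A ** B) = A ** B \<and> transpose (B ** A) = B ** A)"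

definition psd_sqrt :: "real^'n^'n \<Rightarrow> real^'n^'n" where
  "psd_sqrt A = (THE S. transpose S = S \<and> (\<forall>x. 0 \<le> x \<bullet> (S *v x)) \<and> S ** S = A)"

definition inv_sqrt_mat :: "real^'n^'n \<Rightarrow> real^'n^'n" where
  "inv_sqrt_mat A = psd_sqrt (pinv_mat A)"

end

theory Submission
  imports Defs
begin

text \<open>
  Put \<open>\<psi> = Q\<^sub>\<lambda>\<^sup>-\<^sup>1\<^sup>/\<^sup>2 \<phi>(X)\<close> and let \<open>Z\<close> be the centred empirical mean of \<open>\<eta> \<psi>\<close>, where
  \<open>\<eta> = f\<^sub>\<theta>\<^sub>t(X) - Y\<close>. Optimality of the empirical minimiser along the segment to
  \<open>\<theta>\<^sub>t\<close> bounds the excess risk by \<open>2 \<parallel>Z\<parallel>\<^sup>2\<close> as soon as the empirical Gram matrix of \<open>\<psi>\<close>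
  is close to its expectation, which the law of large numbers provides.

  The vector \<open>\<surd>n Z\<close> is asymptotically Gaussian with a covariance \<open>C\<close> whose trace and largest
  eigenvalue are the two noise terms of the bound, so the claim is a tail estimate for its norm.
  To use only the one-dimensional central limit theorem, the Gaussian mixture
  \<open>exp (\<beta> \<parallel>s\<parallel>\<^sup>2 / 2) = E\<^sub>u exp \<langle>u, s\<rangle>\<close> is replaced by a finite one: \<open>u\<close> is a scaled sum of
  random signs along an eigenbasis of \<open>C\<close>. The average of \<open>cosh \<langle>u, s\<rangle>\<close> over \<open>u\<close> is then a product
  of hyperbolic cosines that dominates \<open>exp (\<beta> \<parallel>s\<parallel>\<^sup>2 / 4)\<close> for \<open>s\<close> in a ball, and truncating
  \<open>cosh\<close> makes each term a bounded continuous function of the scalar \<open>\<langle>u, \<surd>n Z\<rangle>\<close>.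
\<close>

section \<open>Spectral calculus for symmetric matrices\<close>

text \<open>A maximiser \<open>x\<close> of the Rayleigh quotient on the unit sphere of
  \<open>V\<close> is an eigenvector: a short step from \<open>x\<close> along the line through the
  residual \<open>w = c x - f x\<close> would otherwise exceed the maximum.\<close>

lemma selfadjoint_eigenvector_exists:
  fixes f :: "'a::euclidean_space \<Rightarrow> 'a"
  assumes f: "linear f" and sa: "\<And>x y. f x \<bullet> y = x \<bullet> f y"
    and V: "subspace V" and inv: "f ` V \<subseteq> V" and nz: "V \<noteq> {0}"
  shows "\<exists>x\<in>V. \<exists>c. norm x = 1 \<and> f x = c *\<^sub>R x"
proof -
  let ?K = "sphere 0 1 \<inter> V"
  have "compact ?K"
    using V by (intro compact_Int_closed closed_subspace) auto
  moreover obtain v where v: "v \<in> V" "v \<noteq> 0"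
    using nz subspace_0[OF V] by blast
  then have "(1 / norm v) *\<^sub>R v \<in> ?K"
    using V by (auto simp: subspace_scale)
  then have "?K \<noteq> {}" by blast
  moreover have "continuous_on ?K (\<lambda>x. x \<bullet> f x)"
    using f by (intro continuous_intros linear_continuous_on) (simp add: linear_conv_bounded_linear)
  ultimately obtain x where x: "x \<in> ?K" and mx: "\<And>y. y \<in> ?K \<Longrightarrow> y \<bullet> f y \<le> x \<bullet> f x"
    using continuous_attains_sup[of ?K "\<lambda>x. x \<bullet> f x"] by blast
  define c where "c = x \<bullet> f x"
  have le: "y \<bullet> f y \<le> c * (y \<bullet> y)" if "y \<in> V" for y
  proof (cases "y = 0")
    case True then show ?thesis using linear_0[OF f] by simp
  next
    case False
    have "(1 / norm y) *\<^sub>R y \<in> ?K" using that V False by (auto simp: subspace_scale)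
    from mx[OF this] have "(y \<bullet> f y) / (norm y * norm y) \<le> c"
      by (simp add: linear_scale[OF f] c_def)
    then show ?thesis using False
      by (simp add: divide_simps dot_square_norm power2_eq_square)
  qed
  define w where "w = c *\<^sub>R x - f x"
  have wV: "w \<in> V" using x V inv by (auto simp: w_def subspace_diff subspace_scale)
  define b where "b = c * (w \<bullet> w) - w \<bullet> f w"
  have xx: "x \<bullet> x = 1" using x by (simp add: dot_square_norm)
  \<comment> \<open>The form \<open>c |y|^2 - y . f y\<close> is nonnegative on \<open>V\<close> and
    vanishes at \<open>x\<close>; this is its expansion at \<open>x + t w\<close>.\<close>
  have q: "0 \<le> 2 * t * (w \<bullet> w) + t * t * b" for t
  proof -
    have "x + t *\<^sub>R w \<in> V" using x wV V by (auto simp: subspace_add subspace_scale)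
    from le[OF this] have "0 \<le> c * ((x + t *\<^sub>R w) \<bullet> (x + t *\<^sub>R w)) - (x + t *\<^sub>R w) \<bullet> f (x + t *\<^sub>R w)"
      by simp
    also have "\<dots> = 2 * t * (c * (x \<bullet> w) - f x \<bullet> w) + t * t * b"
      using sa[of x w] inner_commute[of w "f x"] inner_commute[of w x]
      by (simp add: linear_add[OF f] linear_scale[OF f] inner_add_left inner_add_right xx b_def
          c_def[symmetric] algebra_simps)
    also have "c * (x \<bullet> w) - f x \<bullet> w = w \<bullet> w" by (simp add: w_def inner_diff_left)
    finally show ?thesis .
  qed
  have "w \<bullet> w \<le> 0"
  proof (rule ccontr)
    assume "\<not> ?thesis" then have p: "w \<bullet> w > 0" by linarith
    \<comment> \<open>A negative step so short that \<open>|t b| <= w . w\<close>, hence the linear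
      term of \<open>q\<close> wins.\<close>
    define t where "t = - (w \<bullet> w) / (\<bar>b\<bar> + 1)"
    have t: "t < 0" using p unfolding t_def by (intro divide_neg_pos) auto
    have "t * b \<ge> - (w \<bullet> w)"
    proof -
      have "\<bar>t * b\<bar> = (w \<bullet> w) * (\<bar>b\<bar> / (\<bar>b\<bar> + 1))"
        using p by (simp add: t_def abs_mult)
      also have "\<dots> \<le> (w \<bullet> w) * 1" using p by (intro mult_left_mono) auto
      finally show ?thesis by simp
    qed
    then have "0 < 2 * (w \<bullet> w) + t * b" using p by linarith
    then have "t * (2 * (w \<bullet> w) + t * b) < 0" using t by (rule mult_neg_pos[rotated])
    then show False using q[of t] by (simp add: algebra_simps)
  qed
  then have "w = 0" by (metis inner_ge_zero inner_eq_zero_iff order_antisym)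
  then have "f x = c *\<^sub>R x" by (simp add: w_def)
  then show ?thesis using x by auto
qed

text \<open>Induction on the dimension: a unit eigenvector is split off, and its orthogonal
  complement in \<open>V\<close> is again invariant because \<open>f\<close> is self-adjoint. The
  induction needs general invariant subspaces.\<close>

lemma selfadjoint_eigenbasis_subspace:
  fixes f :: "'a::euclidean_space \<Rightarrow> 'a"
  assumes f: "linear f" and sa: "\<And>x y. f x \<bullet> y = x \<bullet> f y"
  shows "subspace V \<Longrightarrow> f ` V \<subseteq> V \<Longrightarrow>
    \<exists>B. finite B \<and> pairwise orthogonal B \<and> span B = V \<and> (\<forall>b\<in>B. norm b = 1 \<and> (\<exists>c. f b = c *\<^sub>R b))"
proof (induction "dim V" arbitrary: V rule: less_induct)
  case less
  note V = less.prems(1) and inv = less.prems(2)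
  show ?case
  proof (cases "V = {0}")
    case True
    then show ?thesis by (intro exI[of _ "{}"]) auto
  next
    case False
    then obtain x c where x: "x \<in> V" "norm x = 1" "f x = c *\<^sub>R x"
      using selfadjoint_eigenvector_exists[OF f sa V inv] by auto
    have xx: "x \<bullet> x = 1" using x by (simp add: dot_square_norm)
    define W where "W = {y\<in>V. x \<bullet> y = 0}"
    have W: "subspace W" using V by (auto simp: W_def subspace_def inner_add_right)
    have invW: "f ` W \<subseteq> W"
    proof
      fix z assume "z \<in> f ` W"
      then obtain y where y: "y \<in> V" "x \<bullet> y = 0" "z = f y" by (auto simp: W_def)
      have "x \<bullet> f y = 0" using sa[of x y] x y by simp
      then show "z \<in> W" using y inv by (auto simp: W_def)
    qed
    have "x \<notin> W" using xx by (simp add: W_def)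
    then have "W \<subset> V" using x(1) unfolding W_def by blast
    then have "dim W < dim V" using V W by (intro dim_psubset) (simp add: span_eq_iff[THEN iffD2])
    from less.hyps[OF this W invW] obtain B where
      B: "finite B" "pairwise orthogonal B" "span B = W" "\<forall>b\<in>B. norm b = 1 \<and> (\<exists>c. f b = c *\<^sub>R b)"
      by blast
    have BW: "B \<subseteq> W" using B(3) span_superset by blast
    have "span (insert x B) = V"
    proof
      show "span (insert x B) \<subseteq> V" using x BW V by (intro span_minimal) (auto simp: W_def)
      show "V \<subseteq> span (insert x B)"
      proof
        fix v assume v: "v \<in> V"
        have "v - (x \<bullet> v) *\<^sub>R x \<in> W"
          using v x V xx by (auto simp: W_def subspace_diff subspace_scale inner_diff_right)
        then show "v \<in> span (insert x B)" using B(3) by (auto simp: span_insert)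
      qed
    qed
    moreover have "pairwise orthogonal (insert x B)"
      using B(2) BW by (auto simp: pairwise_insert W_def orthogonal_def inner_commute)
    ultimately show ?thesis using B x by (intro exI[of _ "insert x B"]) auto
  qed
qed

section \<open>Matrices diagonal in an orthonormal basis\<close>

definition onb :: "('n \<Rightarrow> real^'n) \<Rightarrow> bool" where
  "onb e \<longleftrightarrow> (\<forall>i j. e i \<bullet> e j = (if i = j then 1 else 0))"

text \<open>The sum of \<open>g j\<close> times the rank-one matrix of \<open>e j\<close>. For an
  orthonormal family, products, inverses and roots of such matrices become pointwise operations on
  \<open>g\<close>.\<close>

definition spec_mat :: "('n \<Rightarrow> real^'n) \<Rightarrow> ('n \<Rightarrow> real) \<Rightarrow> real^'n^'n" where
  "spec_mat e g = (\<chi> i k. \<Sum>j\<in>UNIV. g j * (e j $ i) * (e j $ k))"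

lemma spec_mat_mult_vec: "spec_mat e g *v x = (\<Sum>j\<in>UNIV. (g j * (e j \<bullet> x)) *\<^sub>R e j)"
proof (rule vec_eq_iff[THEN iffD2], rule allI)
  fix i
  have "(spec_mat e g *v x) $ i = (\<Sum>k\<in>UNIV. \<Sum>j\<in>UNIV. g j * (e j $ i) * (e j $ k) * x $ k)"
    by (simp add: spec_mat_def matrix_vector_mult_def sum_distrib_right)
  also have "\<dots> = (\<Sum>j\<in>UNIV. \<Sum>k\<in>UNIV. g j * (e j $ i) * (e j $ k) * x $ k)"
    by (rule sum.swap)
  also have "\<dots> = (\<Sum>j\<in>UNIV. (g j * (e j \<bullet> x)) *\<^sub>R e j) $ i"
    by (simp add: inner_vec_def sum_distrib_left sum_distrib_right algebra_simps)
  finally show "(spec_mat e g *v x) $ i = (\<Sum>j\<in>UNIV. (g j * (e j \<bullet> x)) *\<^sub>R e j) $ i" .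
qed

lemma transpose_spec_mat [simp]: "transpose (spec_mat e g) = spec_mat e g"
  by (simp add: spec_mat_def transpose_def vec_eq_iff mult.assoc mult.commute mult.left_commute)

text \<open>Completeness of the basis: the rows of \<open>U\<close> are orthonormal, and a one-sided
  inverse of a square matrix is two-sided.\<close>

lemma spec_mat_one:
  assumes "onb e" shows "spec_mat e (\<lambda>_. 1) = mat 1"
proof -
  define U :: "real^'a^'a" where "U = (\<chi> j. e j)"
  have "U ** transpose U = mat 1"
    using assms by (simp add: U_def matrix_matrix_mult_def transpose_def mat_def vec_eq_iff onb_def inner_vec_def)
  then have "transpose U ** U = mat 1" by (simp add: matrix_left_right_inverse)
  then show ?thesis
    by (simp add: spec_mat_def U_def matrix_matrix_mult_def transpose_def)
qed

lemma onb_expand: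
  assumes "onb e" shows "x = (\<Sum>j\<in>UNIV. (e j \<bullet> x) *\<^sub>R e j)"
  using spec_mat_mult_vec[of e "\<lambda>_. 1" x] by (simp add: spec_mat_one[OF assms])

lemma onb_inner_sum:
  assumes "onb e" shows "e l \<bullet> (\<Sum>j\<in>UNIV. c j *\<^sub>R e j) = c l"
  using assms by (simp add: inner_sum_right onb_def if_distrib[of "(*) _"] cong: if_cong)

lemma inner_spec_mat:
  assumes "onb e" shows "e l \<bullet> (spec_mat e g *v x) = g l * (e l \<bullet> x)"
  by (simp add: spec_mat_mult_vec onb_inner_sum[OF assms])

lemma onb_eqI:
  assumes "onb e" "\<And>l. e l \<bullet> x = e l \<bullet> y" shows "x = y"
  by (subst onb_expand[OF assms(1), of x], subst onb_expand[OF assms(1), of y]) (simp add: assms(2))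

lemma onb_parseval:
  assumes "onb e" shows "x \<bullet> y = (\<Sum>j\<in>UNIV. (e j \<bullet> x) * (e j \<bullet> y))"
  by (subst onb_expand[OF assms, of y]) (simp add: inner_sum_right inner_commute mult.commute)

lemma onb_norm_square:
  assumes "onb e" shows "(norm x)\<^sup>2 = (\<Sum>j\<in>UNIV. (e j \<bullet> x)\<^sup>2)"
  unfolding power2_norm_eq_inner onb_parseval[OF assms, of x x] by (simp add: power2_eq_square)

lemma spec_mat_mult:
  assumes "onb e" shows "spec_mat e g ** spec_mat e h = spec_mat e (\<lambda>j. g j * h j)"
proof -
  have "(spec_mat e g ** spec_mat e h) *v x = spec_mat e (\<lambda>j. g j * h j) *v x" for x
    by (rule onb_eqI[OF assms])
       (simp add: matrix_vector_mul_assoc[symmetric] inner_spec_mat[OF assms])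
  then show ?thesis by (simp add: matrix_eq)
qed

lemma eq_spec_matI:
  assumes "onb e" "\<And>j. A *v e j = g j *\<^sub>R e j" shows "A = spec_mat e g"
proof -
  have "A *v x = spec_mat e g *v x" for x
    by (subst onb_expand[OF assms(1), of x])
       (simp add: spec_mat_mult_vec matrix_vector_mult_scaleR linear_sum assms(2) mult.commute
         matrix_vector_mul_linear[THEN linear_sum])
  then show ?thesis by (simp add: matrix_eq)
qed

text \<open>The eigenvectors form a basis, so there are exactly \<open>CARD('n)\<close> of them and
  they can be indexed by \<open>'n\<close> itself.\<close>

lemma spectral_theorem:
  fixes A :: "real^'n^'n"
  assumes "transpose A = A"
  obtains e g where "onb e" "A = spec_mat e g"
proof -
  have sa: "(A *v x) \<bullet> y = x \<bullet> (A *v y)" for x y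
    using dot_lmul_matrix[of x A y] assms
    by (metis inner_commute transpose_matrix_vector)
  obtain B where B: "finite B" "pairwise orthogonal B" "span B = (UNIV :: (real^'n) set)"
      "\<forall>b\<in>B. norm b = 1 \<and> (\<exists>c. A *v b = c *\<^sub>R b)"
    using selfadjoint_eigenbasis_subspace[of "(*v) A" UNIV] sa by (auto simp: matrix_vector_mul_linear)
  have "independent B" using B by (intro pairwise_orthogonal_independent) force+
  then have "card B = CARD('n)" using B(3) by (metis dim_UNIV dim_span_eq_card_independent DIM_cart DIM_real mult_1_right)
  then obtain e where e: "bij_betw e (UNIV :: 'n set) B"
    using B(1) by (metis finite_same_card_bij finite)
  have eB: "e j \<in> B" for j using e by (auto simp: bij_betw_def)
  have o: "onb e"
    unfolding onb_def
  proof (intro allI)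
    fix i j
    have "i \<noteq> j \<Longrightarrow> e i \<noteq> e j" using e by (auto simp: bij_betw_def inj_on_def)
    moreover have "e i \<bullet> e i = 1" using B(4) eB by (simp add: dot_square_norm)
    ultimately show "e i \<bullet> e j = (if i = j then 1 else 0)"
      using B(2) eB by (auto simp: pairwise_def orthogonal_def)
  qed
  have "\<forall>j. \<exists>c. A *v e j = c *\<^sub>R e j" using B(4) eB by auto
  then obtain g where "\<And>j. A *v e j = g j *\<^sub>R e j" by metis
  with o show thesis using that eq_spec_matI by blast
qed

section \<open>Characteristic polynomial, pseudo-inverse and square root\<close>

text \<open>The diagonalisation is carried out over the ring of real polynomials: with
  \<open>U\<close> the constant matrix of eigenvectors, \<open>X ** U = U ** Dg\<close>, and
  \<open>det U\<close> cancels because its square is 1.\<close>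

lemma charpoly_spec_mat:
  assumes "onb e"
  shows "charpoly_mat (spec_mat e g) = (\<Prod>j\<in>UNIV. [:- g j, 1:])"
proof -
  let ?A = "spec_mat e g"
  define U :: "real poly^'a^'a" where "U = (\<chi> i j. [:e j $ i:])"
  define X :: "real poly^'a^'a" where "X = (\<chi> i j. (if i = j then [:0, 1:] else 0) - [:?A $ i $ j:])"
  define Dg :: "real poly^'a^'a" where "Dg = (\<chi> i j. if i = j then [:- g j, 1:] else 0)"
  have ev: "(\<Sum>k\<in>UNIV. ?A $ i $ k * e j $ k) = g j * e j $ i" for i j
  proof -
    have "?A *v e j = g j *\<^sub>R e j"
      by (rule onb_eqI[OF assms]) (use assms in \<open>simp add: inner_spec_mat onb_def\<close>)
    then have "(?A *v e j) $ i = g j * e j $ i" by simp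
    then show ?thesis by (simp add: matrix_vector_mult_def)
  qed
  have pc: "(\<Sum>k\<in>K. [:h k:]) = [:\<Sum>k\<in>K. h k:]" for h :: "'a \<Rightarrow> real" and K
    by (induction K rule: infinite_finite_induct) auto
  have "X ** U = U ** Dg"
    unfolding vec_eq_iff
  proof (intro allI)
    fix i j
    have "(X ** U) $ i $ j = (\<Sum>k\<in>UNIV. (if i = k then [:0, e j $ i:] else 0) - [:?A $ i $ k * e j $ k:])"
      by (simp add: X_def U_def matrix_matrix_mult_def left_diff_distrib if_distrib[of "\<lambda>x. x * _"] cong: if_cong)
        (intro sum.cong, auto)
    also have "\<dots> = [:0, e j $ i:] - [:g j * e j $ i:]"
      by (simp add: sum_subtractf pc ev)
    also have "\<dots> = (U ** Dg) $ i $ j"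
      by (simp add: U_def Dg_def matrix_matrix_mult_def if_distrib[of "\<lambda>x. _ * x"] cong: if_cong)
    finally show "(X ** U) $ i $ j = (U ** Dg) $ i $ j" .
  qed
  then have "det X * det U = det U * det Dg" by (metis det_mul)
  moreover have "transpose U ** U = mat 1"
    unfolding vec_eq_iff
  proof (intro allI)
    fix i j
    have "(transpose U ** U) $ i $ j = [:e i \<bullet> e j:]"
      by (simp add: U_def matrix_matrix_mult_def transpose_def pc inner_vec_def mult.commute)
    then show "(transpose U ** U) $ i $ j = (mat 1 :: real poly^'a^'a) $ i $ j"
      using assms by (simp add: onb_def mat_def)
  qed
  then have "det U * det U = 1" by (metis det_mul det_transpose det_I)
  then have "det U \<noteq> 0" by auto
  ultimately have "det X = det Dg" by (simp add: mult.commute)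
  also have "\<dots> = (\<Prod>j\<in>UNIV. [:- g j, 1:])" by (subst det_diagonal) (auto simp: Dg_def)
  finally show ?thesis by (simp add: charpoly_mat_def X_def)
qed

text \<open>Turns sums over the eigenvalue multiset, such as the effective dimension, into sums over
  an eigenbasis.\<close>

lemma eigenvalues_spec_mat:
  assumes "onb e"
  shows "eigenvalues_mset (spec_mat e g) = image_mset g (mset_set UNIV)"
proof -
  have "eigenvalues_mset (spec_mat e g) = (\<Sum>j\<in>UNIV. {#g j#})"
    by (simp add: eigenvalues_mset_def charpoly_spec_mat[OF assms] proots_prod)
  also have "\<dots> = image_mset g (mset_set UNIV)"
    using sum_unfold_sum_mset[of "\<lambda>j. {#g j#}" UNIV] by (simp add: image_mset.compositionality)
  finally show ?thesis .
qed

text \<open>Since \<open>inverse 0 = 0\<close>, inverting \<open>g\<close> pointwise yields the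
  Moore-Penrose inverse for singular matrices too. Uniqueness follows from the four Penrose
  equations.\<close>

lemma pinv_mat_spec_mat:
  assumes "onb e"
  shows "pinv_mat (spec_mat e g) = spec_mat e (\<lambda>j. inverse (g j))"
  unfolding pinv_mat_def
proof (rule the_equality)
  let ?A = "spec_mat e g" and ?B = "spec_mat e (\<lambda>j. inverse (g j))"
  have r: "g j * inverse (g j) * g j = g j" "inverse (g j) * g j * inverse (g j) = inverse (g j)" for j
    by (cases "g j = 0"; simp)+
  show B: "?A ** ?B ** ?A = ?A \<and> ?B ** ?A ** ?B = ?B \<and> transpose (?A ** ?B) = ?A ** ?B
      \<and> transpose (?B ** ?A) = ?B ** ?A"
    by (simp add: spec_mat_mult[OF assms] r)
  fix C assume C: "?A ** C ** ?A = ?A \<and> C ** ?A ** C = C \<and> transpose (?A ** C) = ?A ** C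
      \<and> transpose (C ** ?A) = C ** ?A"
  \<comment> \<open>A candidate \<open>C\<close> has the same products with \<open>?A\<close> as
    \<open>?B\<close> has, on either side; then
    \<open>C = C A C = B A C = B A B = B\<close>.\<close>
  have "?A ** C = ?A ** ?B"
  proof -
    have "?A ** C = transpose (?A ** C)" using C by simp
    also have "\<dots> = transpose ((?A ** ?B ** ?A) ** C)" using B by simp
    also have "\<dots> = transpose (?A ** C) ** transpose (?A ** ?B)"
      by (metis matrix_mul_assoc matrix_transpose_mul)
    also have "\<dots> = (?A ** C ** ?A) ** ?B" using B C by (simp add: matrix_mul_assoc)
    finally show ?thesis using C by simp
  qed
  moreover have "C ** ?A = ?B ** ?A"
  proof -
    have "C ** ?A = transpose (C ** ?A)" using C by simp
    also have "\<dots> = transpose (C ** (?A ** ?B ** ?A))" using B by simp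
    also have "\<dots> = transpose (?B ** ?A) ** transpose (C ** ?A)"
      by (metis matrix_mul_assoc matrix_transpose_mul)
    also have "\<dots> = ?B ** (?A ** C ** ?A)" using B C by (metis matrix_mul_assoc)
    finally show ?thesis using C by simp
  qed
  ultimately show "C = ?B" using B C by (metis matrix_mul_assoc)
qed

text \<open>For uniqueness a second root \<open>C\<close> is diagonalised in its own basis
  \<open>f\<close>. Comparing squares, \<open>h l * h l = g j\<close> whenever \<open>f l\<close>
  and \<open>e j\<close> are not orthogonal, and nonnegativity then determines
  \<open>h l\<close>.\<close>

lemma psd_sqrt_spec_mat:
  assumes e: "onb e" and nn: "\<And>j. 0 \<le> g j"
  shows "psd_sqrt (spec_mat e g) = spec_mat e (\<lambda>j. sqrt (g j))"
  unfolding psd_sqrt_def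
proof (rule the_equality)
  let ?S = "spec_mat e (\<lambda>j. sqrt (g j))"
  have "0 \<le> x \<bullet> (?S *v x)" for x
    unfolding onb_parseval[OF e, of x] inner_spec_mat[OF e]
    by (intro sum_nonneg) (simp add: nn mult.left_commute)
  then show "transpose ?S = ?S \<and> (\<forall>x. 0 \<le> x \<bullet> (?S *v x)) \<and> ?S ** ?S = spec_mat e g"
    by (simp add: spec_mat_mult[OF e] nn)
  fix C assume C: "transpose C = C \<and> (\<forall>x. 0 \<le> x \<bullet> (C *v x)) \<and> C ** C = spec_mat e g"
  then obtain f h where f: "onb f" and h: "C = spec_mat f h" using spectral_theorem[of C] by blast
  have h0: "0 \<le> h j" for j
  proof -
    have "f j \<bullet> (C *v f j) = h j" using f by (simp add: h inner_spec_mat onb_def)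
    then show ?thesis using C by metis
  qed
  have CC: "spec_mat f (\<lambda>j. h j * h j) = spec_mat e g" using C h spec_mat_mult[OF f] by simp
  show "C = ?S"
  proof (rule eq_spec_matI[OF e])
    fix j
    have E: "spec_mat e g *v e j = g j *\<^sub>R e j"
      by (rule onb_eqI[OF e]) (use e in \<open>simp add: inner_spec_mat onb_def\<close>)
    show "C *v e j = sqrt (g j) *\<^sub>R e j"
    proof (rule onb_eqI[OF f])
      fix l
      have "f l \<bullet> (spec_mat f (\<lambda>j. h j * h j) *v e j) = g j * (f l \<bullet> e j)"
        by (simp add: CC E)
      then have "(h l * h l) * (f l \<bullet> e j) = g j * (f l \<bullet> e j)" by (simp add: inner_spec_mat[OF f])
      then have "f l \<bullet> e j = 0 \<or> h l * h l = g j" by simp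
      then have "f l \<bullet> e j = 0 \<or> h l = sqrt (g j)" using h0[of l] by (metis abs_of_nonneg real_sqrt_mult_self real_sqrt_abs2)
      then show "f l \<bullet> (C *v e j) = f l \<bullet> (sqrt (g j) *\<^sub>R e j)"
        by (auto simp: h inner_spec_mat[OF f])
    qed
  qed
qed

text \<open>An eigenvalue 0 is sent to 0, so for a singular matrix this inverts the root on the
  range and annihilates the kernel.\<close>

lemma inv_sqrt_spec_mat:
  assumes "onb e" "\<And>j. 0 \<le> g j"
  shows "inv_sqrt_mat (spec_mat e g) = spec_mat e (\<lambda>j. inverse (sqrt (g j)))"
  by (simp add: inv_sqrt_mat_def pinv_mat_spec_mat psd_sqrt_spec_mat assms real_sqrt_inverse)

section \<open>Averages over random signs\<close>

lemma sinh_le_mult_cosh: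
  assumes "0 \<le> (x::real)" shows "sinh x \<le> x * cosh x"
proof -
  have "\<exists>y. ((\<lambda>x. x * cosh x - sinh x) has_real_derivative y) (at z) \<and> 0 \<le> y" if "0 \<le> z" for z :: real
    by (rule exI[of _ "z * sinh z"]) (auto intro!: derivative_eq_intros simp: that)
  then have "0 * cosh 0 - sinh 0 \<le> x * cosh x - sinh x"
    using assms by (intro DERIV_nonneg_imp_nondecreasing[of 0 x "\<lambda>x. x * cosh x - sinh x"]) auto
  then show ?thesis by simp
qed

text \<open>A random sign is subgaussian: \<open>cosh x * exp (- x^2 / 2)\<close> is nonincreasing
  for nonnegative \<open>x\<close>, its derivative having the sign of
  \<open>sinh x - x cosh x\<close>.\<close>

lemma cosh_le_exp_half_square: "cosh (x::real) \<le> exp (x\<^sup>2 / 2)"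
proof -
  have *: "cosh x \<le> exp (x\<^sup>2 / 2)" if "0 \<le> x" for x :: real
  proof -
    let ?g = "\<lambda>x::real. cosh x * exp (- (x\<^sup>2 / 2))"
    have "\<exists>y. (?g has_real_derivative y) (at z) \<and> y \<le> 0" if "0 \<le> z" for z :: real
      using sinh_le_mult_cosh[OF that]
      by (intro exI[of _ "(sinh z - z * cosh z) * exp (- (z\<^sup>2 / 2))"])
         (auto intro!: derivative_eq_intros mult_nonpos_nonneg simp: algebra_simps)
    then have "?g x \<le> ?g 0"
      using that by (intro DERIV_nonpos_imp_nonincreasing[of 0 x ?g]) auto
    then show ?thesis by (simp add: exp_minus divide_simps)
  qed
  show ?thesis using *[of "\<bar>x\<bar>"] by simp
qed

text \<open>Both sides are compared with \<open>1 + x^2 / 2\<close>. The restriction to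
  \<open>[-1, 1]\<close> is the reason for using many small signs later on.\<close>

lemma exp_quarter_square_le_cosh:
  assumes "\<bar>x\<bar> \<le> (1::real)" shows "exp (x\<^sup>2 / 4) \<le> cosh x"
proof -
  have "x\<^sup>2 \<le> 1" using assms abs_square_le_1 by blast
  then have "exp (x\<^sup>2 / 4) \<le> 1 + x\<^sup>2 / 4 + (x\<^sup>2 / 4)\<^sup>2" by (intro exp_bound) auto
  also have "(x\<^sup>2 / 4)\<^sup>2 \<le> x\<^sup>2 / 4"
    using \<open>x\<^sup>2 \<le> 1\<close> mult_left_le[of "x\<^sup>2/4" "x\<^sup>2/4"] by (simp add: power2_eq_square)
  also have "1 + x\<^sup>2 / 4 + x\<^sup>2 / 4 = 1 + 2 * (x / 2)\<^sup>2" by (simp add: power2_eq_square)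
  also have "\<dots> \<le> 1 + 2 * (sinh (x / 2))\<^sup>2"
    using real_le_abs_sinh[of "x/2"] abs_le_square_iff[of "x/2" "sinh (x/2)"]
    by (simp add: sinh_field_def exp_minus)
  also have "\<dots> = cosh x"
    using cosh_double[of "x/2"] by (simp add: cosh_square_eq)
  finally show ?thesis by simp
qed

text \<open>Expectation of \<open>G\<close> at \<open>x\<close> plus a sum of independent random signs times the vectors of the list.\<close>

fun sign_avg :: "'a::real_inner list \<Rightarrow> ('a \<Rightarrow> real) \<Rightarrow> 'a \<Rightarrow> real" where
  "sign_avg [] G x = G x"
| "sign_avg (v # vs) G x = (sign_avg vs G (x + v) + sign_avg vs G (x - v)) / 2"

text \<open>The average only visits points within the total step length of \<open>x\<close>. This
  permits truncating \<open>cosh\<close> at a finite level.\<close>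

lemma sign_avg_mono_ball:
  "(\<And>u. norm u \<le> norm x + sum_list (map norm vs) \<Longrightarrow> G u \<le> H u) \<Longrightarrow> sign_avg vs G x \<le> sign_avg vs H x"
proof (induction vs arbitrary: x)
  case (Cons v vs)
  have "sign_avg vs G (x + v) \<le> sign_avg vs H (x + v)"
    using norm_triangle_ineq[of x v] by (intro Cons.IH Cons.prems) simp
  moreover have "sign_avg vs G (x - v) \<le> sign_avg vs H (x - v)"
    using norm_triangle_ineq4[of x v] by (intro Cons.IH Cons.prems) simp
  ultimately show ?case by simp
qed simp

lemma sign_avg_mono: "(\<And>u. G u \<le> H u) \<Longrightarrow> sign_avg vs G x \<le> sign_avg vs H x"
  by (rule sign_avg_mono_ball) simp

lemma sign_avg_cmult: "sign_avg vs (\<lambda>u. c * G u) x = c * sign_avg vs G x"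
  by (induction vs arbitrary: x) (auto simp: algebra_simps)

lemma integral_sign_avg:
  assumes "\<And>u. integrable M (\<lambda>\<omega>. F \<omega> u)"
  shows "integrable M (\<lambda>\<omega>. sign_avg vs (F \<omega>) x) \<and>
    (\<integral>\<omega>. sign_avg vs (F \<omega>) x \<partial>M) = sign_avg vs (\<lambda>u. \<integral>\<omega>. F \<omega> u \<partial>M) x"
  by (induction vs arbitrary: x) (simp_all add: assms)

text \<open>Only finitely many points \<open>u\<close> occur, so pointwise eventual bounds combine
  without uniformity in \<open>u\<close>. This is what a finite mixture gains over a Gaussian
  one.\<close>

lemma eventually_sign_avg_le:
  assumes "\<And>u. \<forall>\<^sub>F n in A. G n u \<le> H u"
  shows "\<forall>\<^sub>F n in A. sign_avg vs (G n) x \<le> sign_avg vs H x"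
proof (induction vs arbitrary: x)
  case (Cons v vs)
  show ?case using Cons[of "x + v"] Cons[of "x - v"] by eventually_elim simp
qed (simp add: assms)

text \<open>Each sign contributes one factor, by
  \<open>cosh (a + b) + cosh (a - b) = 2 cosh a cosh b\<close>.\<close>

lemma sign_avg_cosh:
  "sign_avg vs (\<lambda>u. cosh (u \<bullet> S)) x = cosh (x \<bullet> S) * prod_list (map (\<lambda>v. cosh (v \<bullet> S)) vs)"
  by (induction vs arbitrary: x)
     (simp_all add: inner_add_left inner_diff_left cosh_add cosh_diff field_simps)

text \<open>Discrete analogue of the Gaussian integral of the exponential of a square:
  \<open>c\<close> signs of size \<open>h\<close> along \<open>e j\<close> act like a variance
  \<open>h^2 c\<close> and raise the weight \<open>a\<close> to \<open>a / (1 - 2 a h^2 c)\<close>.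
  The induction adds one sign at a time; the smallness assumption keeps all denominators at least
  1/2.\<close>

lemma sign_avg_exp_quadratic:
  fixes e :: "'n::finite \<Rightarrow> real^'n"
  assumes e: "onb e" and a: "\<And>j. 0 \<le> a j"
    and js: "\<And>j. a j * h\<^sup>2 * real (count_list js j) \<le> 1 / 4"
  shows "sign_avg (map (\<lambda>j. h *\<^sub>R e j) js) (\<lambda>u. exp (\<Sum>j\<in>UNIV. a j * (e j \<bullet> u)\<^sup>2)) x
    \<le> exp (\<Sum>j\<in>UNIV. a j / (1 - 2 * a j * h\<^sup>2 * real (count_list js j)) * (e j \<bullet> x)\<^sup>2
             + 2 * a j * h\<^sup>2 * real (count_list js j))"
  using js
proof (induction js arbitrary: x)
  case (Cons i js)
  define c where "c j = real (count_list js j)" for j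
  define \<alpha> where "\<alpha> j = a j / (1 - 2 * a j * h\<^sup>2 * c j)" for j
  have c': "real (count_list (i # js) j) = c j + (if j = i then 1 else 0)" for j by (simp add: c_def)
  have small: "a j * h\<^sup>2 * c j \<le> 1 / 4" for j
    using Cons.prems[of j] mult_left_mono[of "c j" "real (count_list (i # js) j)" "a j * h\<^sup>2"] a[of j]
    unfolding c' by (auto split: if_splits)
  have \<alpha>0: "0 \<le> \<alpha> j" for j using small[of j] a[of j] by (simp add: \<alpha>_def)
  have IH: "sign_avg (map (\<lambda>j. h *\<^sub>R e j) js) (\<lambda>u. exp (\<Sum>j\<in>UNIV. a j * (e j \<bullet> u)\<^sup>2)) y
     \<le> exp (\<Sum>j\<in>UNIV. \<alpha> j * (e j \<bullet> y)\<^sup>2 + 2 * a j * h\<^sup>2 * c j)" for y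
    using Cons.IH[of y] small unfolding \<alpha>_def c_def by blast
  define r where "r = (\<Sum>j\<in>UNIV - {i}. \<alpha> j * (e j \<bullet> x)\<^sup>2 + 2 * a j * h\<^sup>2 * c j)"
  define t where "t = e i \<bullet> x"
  \<comment> \<open>Only the coordinate along \<open>e i\<close> feels the new sign; all others are
    collected in \<open>r\<close>.\<close>
  have split: "(\<Sum>j\<in>UNIV. \<alpha> j * (e j \<bullet> (x + s *\<^sub>R e i))\<^sup>2 + 2 * a j * h\<^sup>2 * c j)
      = \<alpha> i * (t + s)\<^sup>2 + 2 * a i * h\<^sup>2 * c i + r" for s
    using e by (subst sum.remove[of _ i])
      (auto simp: r_def t_def onb_def inner_add_right intro!: sum.cong)
  let ?q = "\<alpha> i * t\<^sup>2 + \<alpha> i * h\<^sup>2 + 2 * a i * h\<^sup>2 * c i + r"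
  have "sign_avg (map (\<lambda>j. h *\<^sub>R e j) (i # js)) (\<lambda>u. exp (\<Sum>j\<in>UNIV. a j * (e j \<bullet> u)\<^sup>2)) x
     \<le> (exp (\<alpha> i * (t + h)\<^sup>2 + 2 * a i * h\<^sup>2 * c i + r) + exp (\<alpha> i * (t - h)\<^sup>2 + 2 * a i * h\<^sup>2 * c i + r)) / 2"
    using IH[of "x + h *\<^sub>R e i"] IH[of "x - h *\<^sub>R e i"] split[of h] split[of "-h"] by simp
  \<comment> \<open>The two exponents differ only in the sign of the cross term, whose average is a
    hyperbolic cosine.\<close>
  also have "\<dots> = exp ?q * cosh (2 * \<alpha> i * t * h)"
    by (simp add: cosh_field_def exp_add[symmetric] distrib_left add_divide_distrib power2_eq_square algebra_simps)
  also have "\<dots> \<le> exp ?q * exp ((2 * \<alpha> i * t * h)\<^sup>2 / 2)"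
    by (intro mult_left_mono cosh_le_exp_half_square) auto
  also have "\<dots> = exp ((\<alpha> i + 2 * (\<alpha> i)\<^sup>2 * h\<^sup>2) * t\<^sup>2 + \<alpha> i * h\<^sup>2 + 2 * a i * h\<^sup>2 * c i + r)"
    by (simp add: exp_add[symmetric] power2_eq_square algebra_simps)
  also have "\<dots> \<le> exp (a i / (1 - 2 * a i * h\<^sup>2 * (c i + 1)) * t\<^sup>2 + 2 * a i * h\<^sup>2 * (c i + 1) + r)"
  proof -
    \<comment> \<open>\<open>d\<close> and \<open>d - w\<close> are the denominators before and
      after the new sign. The updated weight stays below the closed form because
      \<open>(d + w) (d - w) <= d^2\<close>.\<close>
    define d where "d = 1 - 2 * a i * h\<^sup>2 * c i"
    define w where "w = 2 * a i * h\<^sup>2"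
    have d: "d \<ge> 1/2" using small[of i] by (simp add: d_def)
    have w0: "0 \<le> w" using a[of i] by (simp add: w_def)
    have dw: "d - w \<ge> 1/2" using Cons.prems[of i] unfolding c' by (simp add: d_def w_def algebra_simps)
    have "a i \<le> 2 * a i * d" using mult_left_mono[of "1/2" d "2 * a i"] d a[of i] by simp
    then have "\<alpha> i \<le> 2 * a i"
      unfolding \<alpha>_def d_def[symmetric] using d by (simp add: divide_le_eq)
    then have "\<alpha> i * h\<^sup>2 \<le> 2 * a i * h\<^sup>2" by (rule mult_right_mono) simp
    moreover have "\<alpha> i + 2 * (\<alpha> i)\<^sup>2 * h\<^sup>2 \<le> a i / (1 - 2 * a i * h\<^sup>2 * (c i + 1))"
    proof -
      have "\<alpha> i = a i / d" by (simp add: \<alpha>_def d_def)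
      then have "\<alpha> i + 2 * (\<alpha> i)\<^sup>2 * h\<^sup>2 = a i / d + 2 * (a i / d)\<^sup>2 * h\<^sup>2" by simp
      also have "\<dots> = a i * ((d + w) / (d * d))"
        using d by (simp add: w_def field_simps power2_eq_square)
      finally have eq: "\<alpha> i + 2 * (\<alpha> i)\<^sup>2 * h\<^sup>2 = a i * ((d + w) / (d * d))" .
      have "(d + w) / (d * d) \<le> 1 / (d - w)"
      proof -
        have "(d + w) * (d - w) \<le> d * d" by (simp add: algebra_simps)
        then show ?thesis using d dw by (simp add: divide_simps)
      qed
      then have "a i * ((d + w) / (d * d)) \<le> a i * (1 / (d - w))" by (rule mult_left_mono) (rule a)
      also have "d - w = 1 - 2 * a i * h\<^sup>2 * (c i + 1)" by (simp add: d_def w_def algebra_simps)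
      finally show ?thesis by (simp add: eq)
    qed
    then have "(\<alpha> i + 2 * (\<alpha> i)\<^sup>2 * h\<^sup>2) * t\<^sup>2 \<le> a i / (1 - 2 * a i * h\<^sup>2 * (c i + 1)) * t\<^sup>2"
      by (rule mult_right_mono) simp
    ultimately show ?thesis by (simp add: algebra_simps)
  qed
  also have "a i / (1 - 2 * a i * h\<^sup>2 * (c i + 1)) * t\<^sup>2 + 2 * a i * h\<^sup>2 * (c i + 1) + r
     = (\<Sum>j\<in>UNIV. a j / (1 - 2 * a j * h\<^sup>2 * real (count_list (i # js) j)) * (e j \<bullet> x)\<^sup>2
             + 2 * a j * h\<^sup>2 * real (count_list (i # js) j))"
    unfolding c' by (subst sum.remove[of UNIV i]) (auto simp: r_def t_def \<alpha>_def intro!: sum.cong)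
  finally show ?case .
qed simp

text \<open>The standard normal density times \<open>cosh (c x)\<close> is
  \<open>exp (c^2 / 2)\<close> times the average of the unit-variance densities centred at
  \<open>c\<close> and \<open>- c\<close>.\<close>

lemma std_normal_cosh:
  "integrable std_normal_distribution (\<lambda>x. cosh (c * x))"
  "(\<integral>x. cosh (c * x) \<partial>std_normal_distribution) = exp (c\<^sup>2 / 2)"
proof -
  have eq: "std_normal_density x * cosh (c * x)
      = exp (c\<^sup>2 / 2) * (normal_density c 1 x + normal_density (- c) 1 x) / 2" for x
    by (simp add: normal_density_def cosh_field_def exp_add[symmetric] distrib_left power2_eq_square
        field_simps flip: add_divide_distrib)
  have [measurable]: "(\<lambda>x. cosh (c * x)) \<in> borel_measurable borel" by (simp add: cosh_field_def)
  show "integrable std_normal_distribution (\<lambda>x. cosh (c * x))"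
    by (subst integrable_density) (auto simp: eq)
  show "(\<integral>x. cosh (c * x) \<partial>std_normal_distribution) = exp (c\<^sup>2 / 2)"
    by (subst integral_density) (auto simp: eq)
qed

section \<open>Deviations of empirical means\<close>

lemma borel_measurable_cosh [measurable]:
  fixes f :: "'a \<Rightarrow> real"
  shows "f \<in> borel_measurable M \<Longrightarrow> (\<lambda>x. cosh (f x)) \<in> borel_measurable M"
  by (simp add: cosh_field_def)

text \<open>The truncated \<open>cosh\<close> is bounded and continuous, so by the central limit
  theorem its expectations converge to a limit of at most \<open>exp (\<sigma>^2 / 2)\<close>. The
  factor 2 makes the inequality strict in the limit, hence true eventually.\<close>

lemma eventually_integral_min_cosh_le:
  fixes f :: "'a \<Rightarrow> real"
  assumes "prob_space P" and f[measurable]: "f \<in> borel_measurable P"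
    and f2: "integrable P (\<lambda>z. (f z)\<^sup>2)" and f0: "(\<integral>z. f z \<partial>P) = 0" and L: "1 \<le> L"
  shows "\<forall>\<^sub>F n in sequentially.
    (\<integral>\<omega>. min (cosh ((\<Sum>i<n. f (\<omega> i)) / sqrt (real n))) L \<partial>PiM {..<n} (\<lambda>_. P))
      \<le> 2 * exp ((\<integral>z. (f z)\<^sup>2 \<partial>P) / 2)"
proof (cases "(\<integral>z. (f z)\<^sup>2 \<partial>P) = 0")
  \<comment> \<open>The central limit theorem needs positive variance; with zero variance
    \<open>f\<close> vanishes almost everywhere and the integrand is 1.\<close>
  case True
  interpret prob_space P by fact
  have ae: "AE z in P. f z = 0" using True f2 by (subst (asm) integral_nonneg_eq_0_iff_AE) auto
  have "(\<integral>\<omega>. min (cosh ((\<Sum>i<n. f (\<omega> i)) / sqrt (real n))) L \<partial>PiM {..<n} (\<lambda>_. P)) = 1" for n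
  proof -
    interpret Pn: product_prob_space "\<lambda>_. P" "{..<n}" by unfold_locales
    have "AE \<omega> in PiM {..<n} (\<lambda>_. P). \<forall>i\<in>{..<n}. f (\<omega> i) = 0"
      by (intro AE_finite_allI Pn.AE_component ae) auto
    then have "AE \<omega> in PiM {..<n} (\<lambda>_. P). min (cosh ((\<Sum>i<n. f (\<omega> i)) / sqrt (real n))) L = 1"
      by eventually_elim (use L in simp)
    then have "(\<integral>\<omega>. min (cosh ((\<Sum>i<n. f (\<omega> i)) / sqrt (real n))) L \<partial>PiM {..<n} (\<lambda>_. P))
       = (\<integral>\<omega>. 1 \<partial>PiM {..<n} (\<lambda>_. P))"
      by (intro integral_cong_AE) auto
    then show ?thesis by (simp add: Pn.P.prob_space)
  qed
  then show ?thesis by (simp add: True)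
next
  case False
  interpret prob_space P by fact
  \<comment> \<open>The limit theorem needs one space carrying the whole sequence; the finite
    products are recovered below as its projections.\<close>
  interpret M: product_prob_space "\<lambda>_. P" "UNIV :: nat set" by unfold_locales
  let ?M = "PiM (UNIV :: nat set) (\<lambda>_. P)"
  define \<sigma> where "\<sigma> = sqrt (\<integral>z. (f z)\<^sup>2 \<partial>P)"
  have \<sigma>2: "\<sigma>\<^sup>2 = (\<integral>z. (f z)\<^sup>2 \<partial>P)" by (simp add: \<sigma>_def)
  have \<sigma>: "\<sigma> > 0" using False by (simp add: \<sigma>_def less_le)
  have dc: "distr ?M P (\<lambda>\<omega>. \<omega> i) = P" for i by (rule M.PiM_component) simp
  have ind0: "M.P.indep_vars (\<lambda>_. P) (\<lambda>i \<omega>. \<omega> i) (UNIV :: nat set)"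
    by (subst M.P.indep_vars_iff_distr_eq_PiM) (auto simp: dc restrict_UNIV distr_id2)
  have ind: "M.P.indep_vars (\<lambda>_. borel) (\<lambda>i \<omega>. f (\<omega> i)) (UNIV :: nat set)"
    by (rule M.P.indep_vars_compose2[OF ind0]) simp
  have E: "(\<integral>\<omega>. g (\<omega> i) \<partial>?M) = (\<integral>z. g z \<partial>P)" if "g \<in> borel_measurable P" for g :: "'a \<Rightarrow> real" and i
    using integral_distr[of "\<lambda>\<omega>. \<omega> i" ?M P g] that by (simp add: dc)
  have I: "integrable ?M (\<lambda>\<omega>. g (\<omega> i))" if "integrable P g" for g :: "'a \<Rightarrow> real" and i
    using integrable_distr[of "\<lambda>\<omega>. \<omega> i" ?M P g] that by (simp add: dc)
  have D: "distr ?M borel (\<lambda>\<omega>. f (\<omega> i)) = distr P borel f" for i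
    using distr_distr[of f P borel "\<lambda>\<omega>. \<omega> i" ?M] by (simp add: dc comp_def)
  let ?T = "\<lambda>n \<omega>. (\<Sum>i<n. f (\<omega> i)) / sqrt (real n * \<sigma>\<^sup>2)"
  have W: "weak_conv_m (\<lambda>n. distr ?M borel (?T n)) std_normal_distribution"
    by (rule M.P.central_limit_theorem_zero_mean[where \<mu> = "distr P borel f"])
       (use ind \<sigma> in \<open>auto simp: E f0 E[of "\<lambda>z. (f z)\<^sup>2"] \<sigma>2 D intro!: I f2\<close>)
  let ?g = "\<lambda>x. min (cosh (\<sigma> * x)) L"
  have g1: "\<bar>?g x\<bar> \<le> L" for x using L cosh_real_nonneg[of "\<sigma> * x"] by (auto simp: min_def)
  have "(\<lambda>n. integral\<^sup>L (distr ?M borel (?T n)) ?g) \<longlonglongrightarrow> integral\<^sup>L std_normal_distribution ?g"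
  proof (rule weak_conv_imp_integral_bdd_continuous_conv[OF _ _ W])
    show "real_distribution (distr ?M borel (?T n))" for n
      by (intro M.P.real_distribution_distr) simp
    show "isCont ?g x" for x by (intro continuous_intros)
    show "norm (?g x) \<le> L" for x using g1 by simp
  qed (rule real_dist_normal_dist)
  moreover have "integral\<^sup>L std_normal_distribution ?g < 2 * exp (\<sigma>\<^sup>2 / 2)"
  proof -
    interpret N: real_distribution std_normal_distribution by (rule real_dist_normal_dist)
    have "integral\<^sup>L std_normal_distribution ?g \<le> (\<integral>x. cosh (\<sigma> * x) \<partial>std_normal_distribution)"
      by (intro integral_mono std_normal_cosh N.integrable_const_bound[where B = L])
         (use g1 in auto)
    also have "\<dots> = exp (\<sigma>\<^sup>2 / 2)" by (rule std_normal_cosh)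
    finally show ?thesis using exp_gt_zero[of "\<sigma>\<^sup>2 / 2"] by linarith
  qed
  ultimately have "\<forall>\<^sub>F n in sequentially. integral\<^sup>L (distr ?M borel (?T n)) ?g < 2 * exp (\<sigma>\<^sup>2 / 2)"
    by (rule order_tendstoD)
  then show ?thesis
  proof eventually_elim
    case (elim n)
    have [measurable]: "?g \<in> borel_measurable borel" by simp
    have "(\<integral>\<omega>. min (cosh ((\<Sum>i<n. f (\<omega> i)) / sqrt (real n))) L \<partial>PiM {..<n} (\<lambda>_. P))
       = (\<integral>\<omega>. min (cosh ((\<Sum>i<n. f (\<omega> i)) / sqrt (real n))) L \<partial>distr ?M (PiM {..<n} (\<lambda>_. P)) (\<lambda>x. restrict x {..<n}))"
      by (subst M.distr_PiM_restrict_finite) auto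
    also have "\<dots> = (\<integral>\<omega>. min (cosh ((\<Sum>i<n. f (\<omega> i)) / sqrt (real n))) L \<partial>?M)"
      by (subst integral_distr) auto
    also have "\<dots> = (\<integral>\<omega>. ?g (?T n \<omega>) \<partial>?M)"
      using \<sigma> by (intro Bochner_Integration.integral_cong) (auto simp: real_sqrt_mult)
    also have "\<dots> = integral\<^sup>L (distr ?M borel (?T n)) ?g"
      by (subst integral_distr) auto
    finally show ?case using elim by (simp add: \<sigma>2)
  qed
qed

lemma (in prob_space) prob_mult_le_expectation:
  assumes "integrable M f" "\<And>x. x \<in> space M \<Longrightarrow> 0 \<le> f x" "A \<in> sets M" "\<And>x. x \<in> A \<Longrightarrow> c \<le> f x" "0 \<le> c"
  shows "prob A * c \<le> expectation f"
proof -
  have "prob A * c = expectation (\<lambda>x. indicator A x * c)"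
    using assms(3) by simp
  also have "\<dots> \<le> expectation f"
    using assms sets.sets_into_space[OF assms(3)]
    by (intro integral_mono integrable_mult_left integrable_real_indicator) (auto simp: emeasure_eq_measure split: split_indicator)
  finally show ?thesis .
qed

text \<open>A weak law by Markov's inequality: a deviation \<open>c\<close> of the mean is a
  deviation \<open>c * sqrt n\<close> of the normalised sum, where \<open>cosh\<close> becomes
  arbitrarily large.\<close>

lemma eventually_mean_deviation_small:
  fixes f :: "'a \<Rightarrow> real"
  assumes P: "prob_space P" and f[measurable]: "f \<in> borel_measurable P"
    and f2: "integrable P (\<lambda>z. (f z)\<^sup>2)" and f0: "(\<integral>z. f z \<partial>P) = 0" and c: "0 < c" and \<delta>: "0 < \<delta>"
  shows "\<forall>\<^sub>F n in sequentially.
    measure (PiM {..<n} (\<lambda>_. P)) {\<omega> \<in> space (PiM {..<n} (\<lambda>_. P)). c < \<bar>(\<Sum>i<n. f (\<omega> i)) / real n\<bar>} \<le> \<delta>"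
proof -
  define V where "V = 2 * exp ((\<integral>z. (f z)\<^sup>2 \<partial>P) / 2)"
  have "\<forall>\<^sub>F x in at_top. V / \<delta> \<le> cosh (x :: real)"
    using cosh_real_at_top by (simp add: filterlim_at_top)
  then have "\<forall>\<^sub>F n in sequentially. V / \<delta> \<le> cosh (c * sqrt (real n))"
    by (rule eventually_compose_filterlim)
       (auto intro!: filterlim_tendsto_pos_mult_at_top[OF tendsto_const c]
          filterlim_compose[OF sqrt_at_top filterlim_real_sequentially])
  then obtain m where m: "V / \<delta> \<le> cosh (c * sqrt (real m))"
    by (auto simp: eventually_sequentially)
  \<comment> \<open>The truncation level is fixed through \<open>m\<close> before \<open>n\<close>
    varies, since the threshold supplied by \<open>eventually_integral_min_cosh_le\<close> depends
    on \<open>L\<close>.\<close>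
  define L where "L = cosh (c * sqrt (real m))"
  have "1 \<le> L" by (simp add: L_def cosh_real_ge_1)
  from eventually_integral_min_cosh_le[OF P f f2 f0 this] eventually_ge_at_top[of "max 1 m"]
  show ?thesis
  proof eventually_elim
    case (elim n)
    interpret Pn: prob_space "PiM {..<n} (\<lambda>_. P)" by (intro prob_space_PiM P)
    let ?A = "{\<omega> \<in> space (PiM {..<n} (\<lambda>_. P)). c < \<bar>(\<Sum>i<n. f (\<omega> i)) / real n\<bar>}"
    let ?h = "\<lambda>\<omega>. min (cosh ((\<Sum>i<n. f (\<omega> i)) / sqrt (real n))) L"
    have "Pn.prob ?A * L \<le> Pn.expectation ?h"
    proof (rule Pn.prob_mult_le_expectation)
      show "integrable (PiM {..<n} (\<lambda>_. P)) ?h"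
        using \<open>1 \<le> L\<close> by (intro Pn.integrable_const_bound[where B = L]) auto
      fix \<omega> assume "\<omega> \<in> ?A"
      then have "c * sqrt (real n) \<le> \<bar>(\<Sum>i<n. f (\<omega> i)) / real n\<bar> * sqrt (real n)"
        by (intro mult_right_mono) auto
      also have "\<dots> = \<bar>(\<Sum>i<n. f (\<omega> i)) / sqrt (real n)\<bar>"
        using elim(2) by (simp add: abs_mult field_simps)
      finally have "c * sqrt (real n) \<le> \<bar>(\<Sum>i<n. f (\<omega> i)) / sqrt (real n)\<bar>" .
      moreover have "c * sqrt (real m) \<le> c * sqrt (real n)" using elim(2) c by simp
      ultimately have "cosh (c * sqrt (real m)) \<le> cosh \<bar>(\<Sum>i<n. f (\<omega> i)) / sqrt (real n)\<bar>"
        using c by (subst cosh_real_nonneg_le_iff) (simp, simp, linarith)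
      then show "L \<le> ?h \<omega>" unfolding L_def cosh_real_abs by simp
    qed (use \<open>1 \<le> L\<close> in auto)
    also have "\<dots> \<le> V" using elim(1) by (simp add: V_def)
    also have "V \<le> \<delta> * L" using m \<delta> by (simp add: L_def field_simps)
    finally show ?case using \<open>1 \<le> L\<close> by simp
  qed
qed

section \<open>Second moments and norm tails of vector-valued means\<close>

lemma integrable_inner_mult_inner:
  fixes F :: "'a \<Rightarrow> real^'d"
  assumes F[measurable]: "F \<in> borel_measurable P" and F2: "integrable P (\<lambda>z. (norm (F z))\<^sup>2)"
  shows "integrable P (\<lambda>z. (u \<bullet> F z) * (v \<bullet> F z))"
proof (rule Bochner_Integration.integrable_bound)
  show "integrable P (\<lambda>z. norm u * norm v * (norm (F z))\<^sup>2)" using F2 by simp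
  show "AE z in P. norm ((u \<bullet> F z) * (v \<bullet> F z)) \<le> norm (norm u * norm v * (norm (F z))\<^sup>2)"
  proof (rule AE_I2)
    fix z
    have "\<bar>u \<bullet> F z\<bar> * \<bar>v \<bullet> F z\<bar> \<le> (norm u * norm (F z)) * (norm v * norm (F z))"
      by (intro mult_mono Cauchy_Schwarz_ineq2) auto
    then show "norm ((u \<bullet> F z) * (v \<bullet> F z)) \<le> norm (norm u * norm v * (norm (F z))\<^sup>2)"
      by (simp add: abs_mult power2_eq_square algebra_simps)
  qed
qed simp

lemma inner_second_moment:
  fixes F :: "'a \<Rightarrow> real^'d"
  assumes F[measurable]: "F \<in> borel_measurable P" and F2: "integrable P (\<lambda>z. (norm (F z))\<^sup>2)"
  shows "u \<bullet> ((\<chi> i k. \<integral>z. F z $ i * F z $ k \<partial>P) *v v) = (\<integral>z. (u \<bullet> F z) * (v \<bullet> F z) \<partial>P)"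
proof -
  \<comment> \<open>Coordinates are written as inner products with axis vectors so that
    \<open>integrable_inner_mult_inner\<close> covers every summand.\<close>
  have "(u \<bullet> F z) * (v \<bullet> F z)
      = (\<Sum>i\<in>UNIV. \<Sum>k\<in>UNIV. u $ i * v $ k * ((axis i 1 \<bullet> F z) * (axis k 1 \<bullet> F z)))" for z
    by (simp only: inner_axis' inner_vec_def[of u] inner_vec_def[of v] sum_product) (simp add: algebra_simps)
  then have "(\<integral>z. (u \<bullet> F z) * (v \<bullet> F z) \<partial>P) =
     (\<Sum>i\<in>UNIV. \<Sum>k\<in>UNIV. u $ i * v $ k * (\<integral>z. (axis i 1 \<bullet> F z) * (axis k 1 \<bullet> F z) \<partial>P))"
    by (simp add: Bochner_Integration.integral_sum integrable_inner_mult_inner[OF F F2]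
        Bochner_Integration.integrable_sum)
  also have "\<dots> = u \<bullet> ((\<chi> i k. \<integral>z. F z $ i * F z $ k \<partial>P) *v v)"
    by (simp only: inner_axis' matrix_vector_mult_def inner_vec_def[of u]) (simp add: sum_distrib_left algebra_simps)
  finally show ?thesis by simp
qed

lemma sum_list_map_eq_sum_count_real:
  fixes f :: "'n::finite \<Rightarrow> real"
  shows "sum_list (map f js) = (\<Sum>j\<in>UNIV. real (count_list js j) * f j)"
proof (induction js)
  case (Cons i js)
  have "(\<Sum>j\<in>UNIV. real (count_list (i # js) j) * f j)
      = (\<Sum>j\<in>UNIV. real (count_list js j) * f j + (if j = i then f j else 0))"
    by (intro sum.cong) (auto simp: algebra_simps)
  then show ?case using Cons by (simp add: sum.distrib)
qed simp

lemma prod_list_map_exp: "prod_list (map (\<lambda>j. exp (f j :: real)) js) = exp (sum_list (map f js))"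
  by (induction js) (auto simp: exp_add)

lemma prod_list_map_mono_real:
  fixes f g :: "'a \<Rightarrow> real"
  assumes "\<And>x. 0 \<le> f x" "\<And>x. f x \<le> g x"
  shows "prod_list (map f xs) \<le> prod_list (map g xs)"
proof (induction xs)
  case (Cons x xs)
  have "0 \<le> prod_list (map f xs)" using assms(1) by (induction xs) auto
  moreover have "0 \<le> g x" using assms[of x] by linarith
  ultimately show ?case using Cons assms(2)[of x] by (simp add: mult_mono)
qed simp

text \<open>Markov's inequality for the sign average of the truncated \<open>cosh (u . S)\<close>,
  \<open>S\<close> being the normalised sum. Outside the ball the average is at least
  \<open>exp (\<beta> t / 4)\<close>, and eventually its expectation is at most twice the
  exponential of \<open>\<beta>\<close> times the second moment of \<open>F\<close>.\<close>

lemma eventually_norm_mean_tail: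
  fixes F :: "'a \<Rightarrow> real^'d"
  assumes P: "prob_space P" and F[measurable]: "F \<in> borel_measurable P"
    and F2: "integrable P (\<lambda>z. (norm (F z))\<^sup>2)" and F0: "\<And>u. (\<integral>z. u \<bullet> F z \<partial>P) = 0"
    and s: "0 < s" and Fs: "\<And>u. (\<integral>z. (u \<bullet> F z)\<^sup>2 \<partial>P) \<le> s * (norm u)\<^sup>2" and t: "0 < t"
  shows "\<forall>\<^sub>F n in sequentially.
    measure (PiM {..<n} (\<lambda>_. P)) {\<omega> \<in> space (PiM {..<n} (\<lambda>_. P)). t < real n * (norm ((\<Sum>i<n. F (\<omega> i)) /\<^sub>R real n))\<^sup>2}
     \<le> 2 * exp ((\<integral>z. (norm (F z))\<^sup>2 \<partial>P) / (2 * s) - t / (8 * s))"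
proof -
  interpret prob_space P by fact
  note Fu2 = integrable_inner_mult_inner[OF F F2]
  define C :: "real^'d^'d" where "C = (\<chi> i k. \<integral>z. F z $ i * F z $ k \<partial>P)"
  have "transpose C = C" by (simp add: C_def transpose_def vec_eq_iff mult.commute)
  then obtain e g where e: "onb e" and g: "C = spec_mat e g" by (rule spectral_theorem)
  have Cq: "(\<integral>z. (u \<bullet> F z)\<^sup>2 \<partial>P) = u \<bullet> (C *v u)" for u
    by (simp add: C_def inner_second_moment[OF F F2] power2_eq_square)
  have quad: "(\<integral>z. (u \<bullet> F z)\<^sup>2 \<partial>P) = (\<Sum>j\<in>UNIV. g j * (e j \<bullet> u)\<^sup>2)" for u
    unfolding Cq g onb_parseval[OF e, of u "spec_mat e g *v u"] inner_spec_mat[OF e]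
    by (simp add: power2_eq_square algebra_simps)
  have gj: "(\<integral>z. (e j \<bullet> F z)\<^sup>2 \<partial>P) = g j" for j
    unfolding Cq g inner_spec_mat[OF e] using e by (simp add: onb_def)
  have g0: "0 \<le> g j" for j unfolding gj[symmetric] by simp
  have gs: "g j \<le> s" for j
    using Fs[of "e j"] e unfolding gj by (simp add: onb_def power2_norm_eq_inner)
  have gsum: "(\<Sum>j\<in>UNIV. g j) = (\<integral>z. (norm (F z))\<^sup>2 \<partial>P)"
  proof -
    have "(\<integral>z. (norm (F z))\<^sup>2 \<partial>P) = (\<Sum>j\<in>UNIV. \<integral>z. (e j \<bullet> F z)\<^sup>2 \<partial>P)"
      unfolding onb_norm_square[OF e] using Fu2 by (simp add: Bochner_Integration.integral_sum power2_eq_square)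
    then show ?thesis by (simp add: gj)
  qed
  \<comment> \<open>The largest value for which the weights \<open>g j / 2 <= s / 2\<close> meet the
    bound 1/4 required by \<open>sign_avg_exp_quadratic\<close>.\<close>
  define \<beta> where "\<beta> = 1 / (2 * s)"
  have \<beta>: "0 < \<beta>" using s by (simp add: \<beta>_def)
  \<comment> \<open>Each basis direction receives \<open>K\<close> signs of size \<open>h\<close>,
    of total variance \<open>\<beta>\<close>. With \<open>K >= \<beta> t\<close> the argument of
    every \<open>cosh\<close> is at most 1 in absolute value when \<open>|S|^2 = t\<close>.\<close>
  obtain K :: nat where K: "\<beta> * t \<le> real K" using real_arch_simple by blast
  then have K0: "K > 0" using mult_pos_pos[OF \<beta> t] by (cases K) auto
  define h where "h = sqrt (\<beta> / real K)"
  have h2: "h\<^sup>2 = \<beta> / real K" and h0: "0 \<le> h" using \<beta> K0 by (auto simp: h_def)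
  obtain js :: "'d list" where js0: "mset js = repeat_mset K (mset_set UNIV)" using ex_mset by blast
  have js: "count_list js j = K" for j
  proof -
    have "count_list js j = count (mset js) j" by (simp add: count_mset)
    then show ?thesis unfolding js0 by simp
  qed
  define vs where "vs = map (\<lambda>j. h *\<^sub>R e j) js"
  have low: "exp (\<beta> * t / 4) \<le> sign_avg vs (\<lambda>u. cosh (u \<bullet> S)) 0" if S: "(norm S)\<^sup>2 = t" for S
  proof -
    have "\<beta> * t / 4 = (\<Sum>j\<in>UNIV. real K * ((h * (e j \<bullet> S))\<^sup>2 / 4))"
      using K0 by (simp add: S[symmetric] onb_norm_square[OF e, of S] power_mult_distrib h2
          sum_distrib_left sum_divide_distrib)
    also have "\<dots> = sum_list (map (\<lambda>j. (h * (e j \<bullet> S))\<^sup>2 / 4) js)"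
      unfolding sum_list_map_eq_sum_count_real js ..
    finally have "exp (\<beta> * t / 4) = prod_list (map (\<lambda>j. exp ((h * (e j \<bullet> S))\<^sup>2 / 4)) js)"
      by (simp add: prod_list_map_exp)
    also have "\<dots> \<le> prod_list (map (\<lambda>j. cosh (h * (e j \<bullet> S))) js)"
    proof -
      have "\<bar>h * (e j \<bullet> S)\<bar> \<le> 1" for j
      proof -
        have "\<bar>e j \<bullet> S\<bar> \<le> norm (e j) * norm S" by (rule Cauchy_Schwarz_ineq2)
        also have "norm (e j) = 1" using e by (simp add: onb_def norm_eq_sqrt_inner)
        finally have "(e j \<bullet> S)\<^sup>2 \<le> t" using S by (metis abs_le_square_iff abs_norm_cancel mult_1)
        then have "h\<^sup>2 * (e j \<bullet> S)\<^sup>2 \<le> h\<^sup>2 * t" by (intro mult_left_mono) auto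
        also have "\<dots> \<le> 1" using K K0 by (simp add: h2)
        finally show ?thesis by (simp add: power_mult_distrib[symmetric] abs_square_le_1)
      qed
      then show ?thesis
        by (intro prod_list_map_mono_real exp_quarter_square_le_cosh) auto
    qed
    also have "\<dots> = sign_avg vs (\<lambda>u. cosh (u \<bullet> S)) 0"
      by (simp add: sign_avg_cosh vs_def comp_def)
    finally show ?thesis .
  qed
  \<comment> \<open>This bounds \<open>cosh (u . S)\<close> for every \<open>u\<close> that the
    average visits and every \<open>S\<close> of norm \<open>sqrt t\<close>, so the truncation does
    not disturb \<open>low\<close>.\<close>
  define L where "L = cosh (sum_list (map norm vs) * sqrt t)"
  have L1: "1 \<le> L" by (simp add: L_def cosh_real_ge_1)
  have low': "exp (\<beta> * t / 4) \<le> sign_avg vs (\<lambda>u. min (cosh (u \<bullet> S)) L) 0" if S: "t < (norm S)\<^sup>2" for S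
  proof -
    have S0: "norm S > 0" using S t by auto
    \<comment> \<open>A longer \<open>S\<close> is pulled back to the sphere of radius
      \<open>sqrt t\<close>, which can only decrease \<open>|u . S|\<close>.\<close>
    define c where "c = sqrt t / norm S"
    have c: "0 \<le> c" "c \<le> 1" using S S0 t by (auto simp: c_def real_le_lsqrt divide_simps)
    have n: "norm (c *\<^sub>R S) = sqrt t" using S0 t by (simp add: c_def)
    then have "exp (\<beta> * t / 4) \<le> sign_avg vs (\<lambda>u. cosh (u \<bullet> (c *\<^sub>R S))) 0"
      using t by (intro low) simp
    also have "\<dots> \<le> sign_avg vs (\<lambda>u. min (cosh (u \<bullet> S)) L) 0"
    proof (rule sign_avg_mono_ball)
      fix u :: "real^'d" assume u: "norm u \<le> norm (0::real^'d) + sum_list (map norm vs)"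
      have "\<bar>u \<bullet> (c *\<^sub>R S)\<bar> \<le> norm u * sqrt t" using Cauchy_Schwarz_ineq2[of u "c *\<^sub>R S"] n by simp
      also have "\<dots> \<le> sum_list (map norm vs) * sqrt t" using u t by (intro mult_right_mono) auto
      finally have 1: "\<bar>u \<bullet> (c *\<^sub>R S)\<bar> \<le> sum_list (map norm vs) * sqrt t" .
      have 2: "\<bar>u \<bullet> (c *\<^sub>R S)\<bar> \<le> \<bar>u \<bullet> S\<bar>"
        using c by (simp add: abs_mult mult_left_le_one_le)
      have "cosh \<bar>u \<bullet> (c *\<^sub>R S)\<bar> \<le> L"
        unfolding L_def by (subst cosh_real_nonneg_le_iff) (use 1 abs_ge_zero[of "u \<bullet> (c *\<^sub>R S)"] in linarith)+
      moreover have "cosh \<bar>u \<bullet> (c *\<^sub>R S)\<bar> \<le> cosh \<bar>u \<bullet> S\<bar>"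
        by (subst cosh_real_nonneg_le_iff) (use 2 in auto)
      ultimately show "cosh (u \<bullet> (c *\<^sub>R S)) \<le> min (cosh (u \<bullet> S)) L" unfolding cosh_real_abs by simp
    qed
    finally show ?thesis .
  qed
  have up: "sign_avg vs (\<lambda>u. 2 * exp ((\<integral>z. (u \<bullet> F z)\<^sup>2 \<partial>P) / 2)) 0
      \<le> 2 * exp (\<beta> * (\<integral>z. (norm (F z))\<^sup>2 \<partial>P))"
  proof -
    have *: "g j / 2 * h\<^sup>2 * real (count_list js j) \<le> 1 / 4" for j
      using gs[of j] s K0 by (simp add: js h2 \<beta>_def field_simps)
    \<comment> \<open>At the starting point 0 only the constant terms
      \<open>2 (g j / 2) h^2 K = g j * \<beta>\<close> remain.\<close>
    have "sign_avg vs (\<lambda>u. exp (\<Sum>j\<in>UNIV. g j / 2 * (e j \<bullet> u)\<^sup>2)) 0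
       \<le> exp (\<Sum>j\<in>UNIV. g j * \<beta>)"
      using sign_avg_exp_quadratic[OF e, of "\<lambda>j. g j / 2" h js 0] g0 * K0
      by (simp add: vs_def js h2)
    then show ?thesis
      unfolding sign_avg_cmult quad
      by (simp add: gsum[symmetric] sum_distrib_left sum_divide_distrib mult.commute)
  qed
  have "\<forall>\<^sub>F n in sequentially.
     (\<integral>\<omega>. min (cosh ((\<Sum>i<n. u \<bullet> F (\<omega> i)) / sqrt (real n))) L \<partial>PiM {..<n} (\<lambda>_. P))
      \<le> 2 * exp ((\<integral>z. (u \<bullet> F z)\<^sup>2 \<partial>P) / 2)" for u
    using Fu2[of u u] by (intro eventually_integral_min_cosh_le P F0 L1) (auto simp: power2_eq_square)
  then have "\<forall>\<^sub>F n in sequentially.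
     sign_avg vs (\<lambda>u. \<integral>\<omega>. min (cosh ((\<Sum>i<n. u \<bullet> F (\<omega> i)) / sqrt (real n))) L \<partial>PiM {..<n} (\<lambda>_. P)) 0
      \<le> sign_avg vs (\<lambda>u. 2 * exp ((\<integral>z. (u \<bullet> F z)\<^sup>2 \<partial>P) / 2)) 0"
    by (rule eventually_sign_avg_le)
  then show ?thesis
    using eventually_gt_at_top[of 0]
  proof eventually_elim
    case (elim n)
    let ?M = "PiM {..<n} (\<lambda>_. P)"
    interpret Pn: prob_space ?M by (intro prob_space_PiM P)
    let ?h = "\<lambda>\<omega> u. min (cosh ((\<Sum>i<n. u \<bullet> F (\<omega> i)) / sqrt (real n))) L"
    let ?A = "{\<omega> \<in> space ?M. t < real n * (norm ((\<Sum>i<n. F (\<omega> i)) /\<^sub>R real n))\<^sup>2}"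
    have int: "integrable ?M (\<lambda>\<omega>. ?h \<omega> u)" for u
      using L1 by (intro Pn.integrable_const_bound[where B = L]) auto
    have "Pn.prob ?A * exp (\<beta> * t / 4) \<le> (\<integral>\<omega>. sign_avg vs (?h \<omega>) 0 \<partial>?M)"
    proof (rule Pn.prob_mult_le_expectation)
      show "integrable ?M (\<lambda>\<omega>. sign_avg vs (?h \<omega>) 0)"
        using integral_sign_avg[of ?M ?h, OF int] by blast
      show "0 \<le> sign_avg vs (?h \<omega>) 0" for \<omega>
        using sign_avg_mono[of "\<lambda>_. 0 * 0" "?h \<omega>" vs 0] L1 sign_avg_cmult[of vs 0 "\<lambda>_. 0" 0] by auto
      fix \<omega> assume "\<omega> \<in> ?A"
      then have "t < (norm ((\<Sum>i<n. F (\<omega> i)) /\<^sub>R sqrt (real n)))\<^sup>2"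
        using elim(2) by (simp add: power_mult_distrib power2_eq_square field_simps)
      from low'[OF this] have "exp (\<beta> * t / 4)
          \<le> sign_avg vs (\<lambda>u. min (cosh (u \<bullet> ((\<Sum>i<n. F (\<omega> i)) /\<^sub>R sqrt (real n)))) L) 0" .
      also have "(\<lambda>u. u \<bullet> ((\<Sum>i<n. F (\<omega> i)) /\<^sub>R sqrt (real n))) = (\<lambda>u. (\<Sum>i<n. u \<bullet> F (\<omega> i)) / sqrt (real n))"
        by (simp add: inner_sum_right divide_inverse_commute)
      finally show "exp (\<beta> * t / 4) \<le> sign_avg vs (?h \<omega>) 0" .
    qed auto
    also have "\<dots> \<le> 2 * exp (\<beta> * (\<integral>z. (norm (F z))\<^sup>2 \<partial>P))"
      using integral_sign_avg[of ?M ?h vs 0, OF int] elim(1) up by linarith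
    finally have "Pn.prob ?A \<le> 2 * exp (\<beta> * (\<integral>z. (norm (F z))\<^sup>2 \<partial>P)) / exp (\<beta> * t / 4)"
      by (simp add: pos_le_divide_eq)
    also have "\<dots> = 2 * exp ((\<integral>z. (norm (F z))\<^sup>2 \<partial>P) / (2 * s) - t / (8 * s))"
      by (simp add: \<beta>_def exp_diff)
    finally show ?case .
  qed
qed

section \<open>Ridge regression in whitened coordinates\<close>

text \<open>If a quadratic on \<open>[0, 1]\<close> is minimal at 1, its derivative
  \<open>g + 2 k\<close> there cannot be positive.\<close>

lemma quadratic_min_at_right_end:
  fixes c g k :: real
  assumes "\<And>s. 0 \<le> s \<Longrightarrow> s \<le> 1 \<Longrightarrow> c + g + k \<le> c + s * g + s\<^sup>2 * k"
  shows "2 * k + g \<le> 0"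
proof (rule ccontr)
  assume *: "\<not> ?thesis"
  define w where "w = 2 * k + g"
  have p: "w > 0" using * by (simp add: w_def)
  define d where "d = \<bar>k\<bar> + w"
  have d: "d > 0" using p by (simp add: d_def)
  \<comment> \<open>A step back from 1 that stays in the interval and satisfies
    \<open>r * k <= w / 2\<close>.\<close>
  define r where "r = w / (2 * d)"
  have r: "0 < r" "r \<le> 1" using p d by (auto simp: r_def divide_simps) (auto simp: d_def)
  have "r * k \<le> r * d" using p r by (intro mult_left_mono) (auto simp: d_def)
  also have "\<dots> = w / 2" using d by (simp add: r_def)
  finally have "0 < w - r * k" using p by linarith
  then have "0 < r * (w - r * k)" using r by simp
  moreover have "c + g + k \<le> c + (1 - r) * g + (1 - r)\<^sup>2 * k" using r by (intro assms) auto
  ultimately show False by (simp add: w_def power2_eq_square algebra_simps)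
qed

lemma norm_square_eq_sum_axis: "(norm (x :: real^'n))\<^sup>2 = (\<Sum>j\<in>UNIV. (axis j 1 \<bullet> x)\<^sup>2)"
  unfolding inner_axis' power2_norm_eq_inner by (simp add: inner_vec_def power2_eq_square)

text \<open>Below \<open>\<Phi>\<close> stands for \<open>\<phi>(X)\<close> and \<open>\<eta>\<close> for the residual \<open>f\<^sub>\<theta>\<^sub>t(X) - Y\<close>, as functions of one
  observation.\<close>

locale ridge_noise = prob_space M for M :: "'z measure" +
  fixes \<Phi> :: "'z \<Rightarrow> real^'d" and \<eta> :: "'z \<Rightarrow> real" and lam :: real
  assumes \<Phi>_meas [measurable]: "\<Phi> \<in> borel_measurable M"
    and \<eta>_meas [measurable]: "\<eta> \<in> borel_measurable M"
    and \<eta>_sq: "integrable M (\<lambda>z. (\<eta> z)\<^sup>2)"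
    and \<Phi>_4: "integrable M (\<lambda>z. norm (\<Phi> z) ^ 4)"
    and \<Phi>\<eta>: "integrable M (\<lambda>z. (norm (\<Phi> z))\<^sup>2 * (\<eta> z)\<^sup>2)"
    and lam_nonneg: "0 \<le> lam"
begin

section \<open>Whitening the feature vector\<close>

definition Q :: "real^'d^'d" where "Q = (\<chi> i j. \<integral>z. \<Phi> z $ i * \<Phi> z $ j \<partial>M)"

definition T :: "real^'d^'d" where "T = inv_sqrt_mat (Q + lam *\<^sub>R mat 1)"

text \<open>Undoes \<open>T\<close> up to a projection: if \<open>lam = 0\<close> and
  \<open>Q\<close> is singular, \<open>S ** T\<close> is only the orthogonal projection onto the
  range of \<open>Q\<close>. Hence \<open>\<Phi>\<close> is recovered from \<open>\<psi>\<close>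
  almost everywhere rather than everywhere.\<close>

definition S :: "real^'d^'d" where "S = psd_sqrt (Q + lam *\<^sub>R mat 1)"

definition \<psi> :: "'z \<Rightarrow> real^'d" where "\<psi> z = T *v \<Phi> z"

definition noise_trace :: real where "noise_trace = (\<integral>z. (norm (\<psi> z))\<^sup>2 * (\<eta> z)\<^sup>2 \<partial>M)"

text \<open>A vanishing denominator yields the quotient 0, in accordance with the numerator, which
  then vanishes too. In whitened coordinates this value bounds the largest eigenvalue of the
  second-moment matrix of \<open>\<eta> \<psi>\<close>.\<close>

definition noise_sup :: real where
  "noise_sup = (SUP v. (\<integral>z. (v \<bullet> \<Phi> z)\<^sup>2 * (\<eta> z)\<^sup>2 \<partial>M) / ((\<integral>z. (v \<bullet> \<Phi> z)\<^sup>2 \<partial>M) + lam * (norm v)\<^sup>2))"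

definition eff_dim :: real where
  "eff_dim = (\<Sum>\<^sub># (image_mset (\<lambda>\<nu>. if \<nu> > 0 then \<nu> / (\<nu> + lam) else 0) (eigenvalues_mset Q)))"

lemma \<Phi>_2: "integrable M (\<lambda>z. (norm (\<Phi> z))\<^sup>2)"
proof (rule Bochner_Integration.integrable_bound)
  show "integrable M (\<lambda>z. 1 + norm (\<Phi> z) ^ 4)" using \<Phi>_4 by simp
  have "x\<^sup>2 \<le> 1 + x ^ 4" for x :: real
  proof -
    have "0 \<le> (x\<^sup>2 - 1)\<^sup>2" "0 \<le> x\<^sup>2" by simp_all
    moreover have "(x\<^sup>2 - 1)\<^sup>2 = x ^ 4 - 2 * x\<^sup>2 + 1" by (simp add: power2_diff flip: power_mult)
    ultimately show ?thesis by linarith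
  qed
  then show "AE z in M. norm ((norm (\<Phi> z))\<^sup>2) \<le> norm (1 + norm (\<Phi> z) ^ 4)" by simp
qed simp

lemma integrable_\<Phi>\<Phi>: "integrable M (\<lambda>z. (u \<bullet> \<Phi> z) * (v \<bullet> \<Phi> z))"
  by (rule integrable_inner_mult_inner) (simp_all add: \<Phi>_2)

lemma integrable_\<Phi>\<Phi>\<eta>\<eta>: "integrable M (\<lambda>z. ((u \<bullet> \<Phi> z) * (v \<bullet> \<Phi> z)) * (\<eta> z)\<^sup>2)"
proof -
  have "integrable M (\<lambda>z. (u \<bullet> (\<eta> z *\<^sub>R \<Phi> z)) * (v \<bullet> (\<eta> z *\<^sub>R \<Phi> z)))"
    using \<Phi>\<eta> by (intro integrable_inner_mult_inner) (simp_all add: power_mult_distrib mult.commute)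
  then show ?thesis by (simp add: power2_eq_square algebra_simps)
qed

lemma \<psi>_meas [measurable]: "\<psi> \<in> borel_measurable M"
proof -
  have "(\<lambda>z. T *v \<Phi> z) \<in> borel_measurable M"
    by (rule borel_measurable_continuous_on[OF _ \<Phi>_meas])
       (intro linear_continuous_on linear_conv_bounded_linear[THEN iffD1] matrix_vector_mul_linear)
  then show ?thesis by (simp add: \<psi>_def[abs_def])
qed

lemma Q_quad: "u \<bullet> (Q *v v) = (\<integral>z. (u \<bullet> \<Phi> z) * (v \<bullet> \<Phi> z) \<partial>M)"
  unfolding Q_def by (rule inner_second_moment) (simp_all add: \<Phi>_2)

text \<open>All six facts are read off coordinatewise from a single eigenbasis of \<open>Q\<close>,
  in which \<open>S\<close> and \<open>T\<close> are diagonal as well.\<close>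

lemma
  shows transpose_S: "transpose S = S" and transpose_T: "transpose T = T"
    and norm_S: "(norm (S *v v))\<^sup>2 = (\<integral>z. (v \<bullet> \<Phi> z)\<^sup>2 \<partial>M) + lam * (norm v)\<^sup>2"
    and AE_\<Phi>_eq: "AE z in M. \<Phi> z = S *v \<psi> z"
    and norm_ST_le: "norm (S *v (T *v u)) \<le> norm u"
    and eff_dim_eq: "eff_dim = (\<integral>z. (norm (\<psi> z))\<^sup>2 \<partial>M)"
proof -
  have "transpose Q = Q" by (simp add: Q_def transpose_def vec_eq_iff mult.commute)
  then obtain e \<nu> where e: "onb e" and Q: "Q = spec_mat e \<nu>" by (rule spectral_theorem)
  have \<nu>: "(\<integral>z. (e j \<bullet> \<Phi> z)\<^sup>2 \<partial>M) = \<nu> j" for j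
    using Q_quad[of "e j" "e j"] e unfolding Q inner_spec_mat[OF e] by (simp add: onb_def power2_eq_square)
  have \<nu>0: "0 \<le> \<nu> j" for j unfolding \<nu>[symmetric] by simp
  have Ql: "Q + lam *\<^sub>R mat 1 = spec_mat e (\<lambda>j. \<nu> j + lam)"
  proof (rule eq_spec_matI[OF e], rule onb_eqI[OF e])
    fix j l
    show "e l \<bullet> ((Q + lam *\<^sub>R mat 1) *v e j) = e l \<bullet> ((\<nu> j + lam) *\<^sub>R e j)"
      using e by (simp add: matrix_vector_mult_add_rdistrib inner_add_right Q inner_spec_mat
          scaleR_matrix_vector_assoc[symmetric] onb_def)
  qed
  have T: "T = spec_mat e (\<lambda>j. inverse (sqrt (\<nu> j + lam)))"
    unfolding T_def Ql using \<nu>0 lam_nonneg by (intro inv_sqrt_spec_mat e) simp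
  have S: "S = spec_mat e (\<lambda>j. sqrt (\<nu> j + lam))"
    unfolding S_def Ql using \<nu>0 lam_nonneg by (intro psd_sqrt_spec_mat e) simp
  show "transpose S = S" "transpose T = T" by (simp_all add: S T)
  show "(norm (S *v v))\<^sup>2 = (\<integral>z. (v \<bullet> \<Phi> z)\<^sup>2 \<partial>M) + lam * (norm v)\<^sup>2"
  proof -
    have "(\<integral>z. (v \<bullet> \<Phi> z)\<^sup>2 \<partial>M) = (\<Sum>j\<in>UNIV. \<nu> j * (e j \<bullet> v)\<^sup>2)"
      using Q_quad[of v v] unfolding Q onb_parseval[OF e, of v "spec_mat e \<nu> *v v"] inner_spec_mat[OF e]
      by (simp add: power2_eq_square algebra_simps)
    moreover have "(norm (S *v v))\<^sup>2 = (\<Sum>j\<in>UNIV. (\<nu> j + lam) * (e j \<bullet> v)\<^sup>2)"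
      unfolding onb_norm_square[OF e] S inner_spec_mat[OF e]
      using \<nu>0 lam_nonneg by (simp add: power_mult_distrib)
    ultimately show ?thesis
      by (simp add: onb_norm_square[OF e] distrib_right sum.distrib sum_distrib_left)
  qed
  show "AE z in M. \<Phi> z = S *v \<psi> z"
  proof -
    have "AE z in M. \<forall>j\<in>UNIV. e j \<bullet> \<Phi> z = e j \<bullet> (S *v \<psi> z)"
    proof (rule AE_finite_allI)
      fix j
      show "AE z in M. e j \<bullet> \<Phi> z = e j \<bullet> (S *v \<psi> z)"
      proof (cases "\<nu> j + lam = 0")
        \<comment> \<open>A kernel direction of the regularised matrix: the component of
          \<open>\<Phi>\<close> along \<open>e j\<close> has second moment 0 and so vanishes almost
          surely.\<close>
        case True
        then have "\<nu> j = 0" using \<nu>0[of j] lam_nonneg by linarith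
        then have "AE z in M. (e j \<bullet> \<Phi> z)\<^sup>2 = 0"
          using \<nu>[of j] integrable_\<Phi>\<Phi>[of "e j" "e j"]
          by (simp add: integral_nonneg_eq_0_iff_AE power2_eq_square)
        then show ?thesis
          by eventually_elim (simp add: S inner_spec_mat[OF e] True)
      next
        case False
        then show ?thesis using \<nu>0[of j] lam_nonneg
          by (simp add: S \<psi>_def T inner_spec_mat[OF e])
      qed
    qed simp
    then show ?thesis
      by eventually_elim (auto intro: onb_eqI[OF e])
  qed
  show "norm (S *v (T *v u)) \<le> norm u"
  proof -
    have "(norm (S *v (T *v u)))\<^sup>2 \<le> (norm u)\<^sup>2"
      unfolding onb_norm_square[OF e] S T inner_spec_mat[OF e]
    proof (rule sum_mono)
      fix j
      show "(sqrt (\<nu> j + lam) * (inverse (sqrt (\<nu> j + lam)) * (e j \<bullet> u)))\<^sup>2 \<le> (e j \<bullet> u)\<^sup>2"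
        by (cases "sqrt (\<nu> j + lam) = 0") (simp_all add: mult.assoc[symmetric])
    qed
    then show ?thesis by (simp add: abs_le_square_iff[symmetric])
  qed
  show "eff_dim = (\<integral>z. (norm (\<psi> z))\<^sup>2 \<partial>M)"
  proof -
    have "(norm (\<psi> z))\<^sup>2 = (\<Sum>j\<in>UNIV. inverse (\<nu> j + lam) * (e j \<bullet> \<Phi> z)\<^sup>2)" for z
      unfolding onb_norm_square[OF e] \<psi>_def T inner_spec_mat[OF e]
      using \<nu>0 lam_nonneg by (simp add: power_mult_distrib power_inverse)
    then have "(\<integral>z. (norm (\<psi> z))\<^sup>2 \<partial>M) = (\<Sum>j\<in>UNIV. inverse (\<nu> j + lam) * \<nu> j)"
      using integrable_\<Phi>\<Phi> \<nu> by (simp add: Bochner_Integration.integral_sum power2_eq_square)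
    \<comment> \<open>A zero eigenvalue contributes 0 on the left as well, through the factor
      \<open>\<nu> j\<close>.\<close>
    also have "\<dots> = eff_dim"
      unfolding eff_dim_def Q eigenvalues_spec_mat[OF e]
      using \<nu>0 by (auto simp: image_mset.compositionality comp_def sum_unfold_sum_mset[symmetric]
          divide_inverse_commute less_le intro!: sum.cong)
    finally show ?thesis by simp
  qed
qed

lemma inner_\<psi>: "u \<bullet> \<psi> z = (T *v u) \<bullet> \<Phi> z"
  by (metis transpose_T \<psi>_def dot_lmul_matrix inner_commute transpose_matrix_vector)

lemma \<psi>_nth: "\<psi> z $ j = T $ j \<bullet> \<Phi> z"
  by (simp add: \<psi>_def matrix_vector_mult_def inner_vec_def)

lemma \<psi>_nth_meas [measurable]: "(\<lambda>z. \<psi> z $ j) \<in> borel_measurable M"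
  unfolding \<psi>_nth by simp

lemma integrable_\<psi>\<psi>: "integrable M (\<lambda>z. (u \<bullet> \<psi> z) * (v \<bullet> \<psi> z))"
  unfolding inner_\<psi> by (rule integrable_\<Phi>\<Phi>)

lemma integrable_\<psi>\<psi>\<eta>\<eta>: "integrable M (\<lambda>z. ((u \<bullet> \<psi> z) * (v \<bullet> \<psi> z)) * (\<eta> z)\<^sup>2)"
  unfolding inner_\<psi> by (rule integrable_\<Phi>\<Phi>\<eta>\<eta>)

lemma integrable_\<psi>_norm: "integrable M (\<lambda>z. (norm (\<psi> z))\<^sup>2)"
proof -
  have "integrable M (\<lambda>z. \<Sum>j\<in>UNIV. (axis j 1 \<bullet> \<psi> z) * (axis j 1 \<bullet> \<psi> z))"
    using integrable_\<psi>\<psi> by (rule Bochner_Integration.integrable_sum)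
  then show ?thesis unfolding norm_square_eq_sum_axis by (simp add: power2_eq_square)
qed

lemma integrable_\<psi>\<eta>_norm: "integrable M (\<lambda>z. (norm (\<psi> z))\<^sup>2 * (\<eta> z)\<^sup>2)"
proof -
  have "integrable M (\<lambda>z. \<Sum>j\<in>UNIV. ((axis j 1 \<bullet> \<psi> z) * (axis j 1 \<bullet> \<psi> z)) * (\<eta> z)\<^sup>2)"
    using integrable_\<psi>\<psi>\<eta>\<eta> by (rule Bochner_Integration.integrable_sum)
  then show ?thesis unfolding norm_square_eq_sum_axis sum_distrib_right by (simp add: power2_eq_square)
qed

lemma integrable_\<eta>\<Phi>: "integrable M (\<lambda>z. \<eta> z * (u \<bullet> \<Phi> z))"
proof (rule square_integrable_imp_integrable)
  show "integrable M (\<lambda>z. (\<eta> z * (u \<bullet> \<Phi> z))\<^sup>2)"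
    using integrable_\<Phi>\<Phi>\<eta>\<eta>[of u u] by (simp add: power2_eq_square algebra_simps)
qed simp

lemma integrable_\<eta>\<psi>: "integrable M (\<lambda>z. \<eta> z * (u \<bullet> \<psi> z))"
  unfolding inner_\<psi> by (rule integrable_\<eta>\<Phi>)

text \<open>Boundedness gives the real supremum its meaning. Almost surely \<open>v . \<Phi>\<close>
  equals \<open>(S *v v) . \<psi>\<close>, and the squared norm of \<open>S *v v\<close> is the
  denominator, so Cauchy-Schwarz bounds every quotient by \<open>noise_trace\<close>.\<close>

lemma noise_ratio_bdd:
  "bdd_above (range (\<lambda>v. (\<integral>z. (v \<bullet> \<Phi> z)\<^sup>2 * (\<eta> z)\<^sup>2 \<partial>M) / ((\<integral>z. (v \<bullet> \<Phi> z)\<^sup>2 \<partial>M) + lam * (norm v)\<^sup>2)))"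
proof (rule bdd_aboveI2[where M = noise_trace])
  fix v
  have "(\<integral>z. (v \<bullet> \<Phi> z)\<^sup>2 * (\<eta> z)\<^sup>2 \<partial>M) \<le> (\<integral>z. (norm (S *v v))\<^sup>2 * ((norm (\<psi> z))\<^sup>2 * (\<eta> z)\<^sup>2) \<partial>M)"
  proof (rule integral_mono_AE)
    show "integrable M (\<lambda>z. (v \<bullet> \<Phi> z)\<^sup>2 * (\<eta> z)\<^sup>2)"
      using integrable_\<Phi>\<Phi>\<eta>\<eta>[of v v] by (simp add: power2_eq_square)
    show "AE z in M. (v \<bullet> \<Phi> z)\<^sup>2 * (\<eta> z)\<^sup>2 \<le> (norm (S *v v))\<^sup>2 * ((norm (\<psi> z))\<^sup>2 * (\<eta> z)\<^sup>2)"
      using AE_\<Phi>_eq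
    proof eventually_elim
      case (elim z)
      have "v \<bullet> \<Phi> z = (S *v v) \<bullet> \<psi> z"
        by (metis transpose_S elim dot_lmul_matrix transpose_matrix_vector)
      then have "\<bar>v \<bullet> \<Phi> z\<bar> \<le> norm (S *v v) * norm (\<psi> z)" by (simp add: Cauchy_Schwarz_ineq2)
      then have "(v \<bullet> \<Phi> z)\<^sup>2 \<le> (norm (S *v v) * norm (\<psi> z))\<^sup>2" by (metis abs_ge_zero power2_abs power_mono)
      then have "(v \<bullet> \<Phi> z)\<^sup>2 * (\<eta> z)\<^sup>2 \<le> (norm (S *v v) * norm (\<psi> z))\<^sup>2 * (\<eta> z)\<^sup>2"
        by (rule mult_right_mono) simp
      then show ?case by (simp add: power_mult_distrib mult.assoc)
    qed
  qed (simp add: integrable_\<psi>\<eta>_norm)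
  also have "\<dots> = (norm (S *v v))\<^sup>2 * noise_trace" by (simp add: noise_trace_def)
  finally show "(\<integral>z. (v \<bullet> \<Phi> z)\<^sup>2 * (\<eta> z)\<^sup>2 \<partial>M) / ((\<integral>z. (v \<bullet> \<Phi> z)\<^sup>2 \<partial>M) + lam * (norm v)\<^sup>2) \<le> noise_trace"
    unfolding norm_S[symmetric] by (auto simp: divide_simps mult.commute noise_trace_def)
qed

lemma noise_ratio_le: "(\<integral>z. (v \<bullet> \<Phi> z)\<^sup>2 * (\<eta> z)\<^sup>2 \<partial>M) \<le> noise_sup * ((\<integral>z. (v \<bullet> \<Phi> z)\<^sup>2 \<partial>M) + lam * (norm v)\<^sup>2)"
proof (cases "(\<integral>z. (v \<bullet> \<Phi> z)\<^sup>2 \<partial>M) + lam * (norm v)\<^sup>2 = 0")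
  \<comment> \<open>With a zero denominator \<open>v . \<Phi>\<close> vanishes almost surely, so the
    left side is 0 too.\<close>
  case True
  moreover have "0 \<le> (\<integral>z. (v \<bullet> \<Phi> z)\<^sup>2 \<partial>M)" "0 \<le> lam * (norm v)\<^sup>2" using lam_nonneg by auto
  ultimately have "(\<integral>z. (v \<bullet> \<Phi> z)\<^sup>2 \<partial>M) = 0" by linarith
  then have "AE z in M. (v \<bullet> \<Phi> z)\<^sup>2 = 0"
    using integrable_\<Phi>\<Phi>[of v v] by (simp add: integral_nonneg_eq_0_iff_AE power2_eq_square)
  then have "(\<integral>z. (v \<bullet> \<Phi> z)\<^sup>2 * (\<eta> z)\<^sup>2 \<partial>M) = (\<integral>z. 0 \<partial>M)"
    by (intro integral_cong_AE) auto
  then show ?thesis using True by simp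
next
  case False
  moreover have "0 \<le> (\<integral>z. (v \<bullet> \<Phi> z)\<^sup>2 \<partial>M)" "0 \<le> lam * (norm v)\<^sup>2" using lam_nonneg by auto
  ultimately have p: "0 < (\<integral>z. (v \<bullet> \<Phi> z)\<^sup>2 \<partial>M) + lam * (norm v)\<^sup>2" by linarith
  have "(\<integral>z. (v \<bullet> \<Phi> z)\<^sup>2 * (\<eta> z)\<^sup>2 \<partial>M) / ((\<integral>z. (v \<bullet> \<Phi> z)\<^sup>2 \<partial>M) + lam * (norm v)\<^sup>2) \<le> noise_sup"
    unfolding noise_sup_def by (rule cSUP_upper[OF UNIV_I noise_ratio_bdd])
  then show ?thesis using p by (simp add: divide_le_eq)
qed

lemma noise_sup_nonneg: "0 \<le> noise_sup"
  using cSUP_upper[OF UNIV_I[of 0] noise_ratio_bdd] by (simp add: noise_sup_def)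

text \<open>The supremum is tested at \<open>v = T *v u\<close>, whose denominator is the squared
  norm of \<open>S *v (T *v u)\<close> and thus at most that of \<open>u\<close>.\<close>

lemma whitened_noise_le: "(\<integral>z. (u \<bullet> \<psi> z)\<^sup>2 * (\<eta> z)\<^sup>2 \<partial>M) \<le> noise_sup * (norm u)\<^sup>2"
proof -
  have "(\<integral>z. (u \<bullet> \<psi> z)\<^sup>2 * (\<eta> z)\<^sup>2 \<partial>M) \<le> noise_sup * (norm (S *v (T *v u)))\<^sup>2"
    unfolding inner_\<psi> norm_S by (rule noise_ratio_le)
  also have "\<dots> \<le> noise_sup * (norm u)\<^sup>2"
    using norm_ST_le by (intro mult_left_mono power_mono noise_sup_nonneg) auto
  finally show ?thesis .
qed

section \<open>The centred noise vector\<close>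

definition noise_mean :: "real^'d" where "noise_mean = (\<chi> j. \<integral>z. \<eta> z * \<psi> z $ j \<partial>M)"

lemma inner_noise_mean: "u \<bullet> noise_mean = (\<integral>z. \<eta> z * (u \<bullet> \<psi> z) \<partial>M)"
proof -
  have "(\<integral>z. \<eta> z * (u \<bullet> \<psi> z) \<partial>M) = (\<integral>z. (\<Sum>j\<in>UNIV. u $ j * (\<eta> z * (axis j 1 \<bullet> \<psi> z))) \<partial>M)"
    by (simp add: inner_axis') (simp add: inner_vec_def sum_distrib_left algebra_simps)
  also have "\<dots> = (\<Sum>j\<in>UNIV. u $ j * (\<integral>z. \<eta> z * (axis j 1 \<bullet> \<psi> z) \<partial>M))"
    by (simp add: Bochner_Integration.integral_sum integrable_\<eta>\<psi>)
  also have "\<dots> = u \<bullet> noise_mean"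
    by (simp add: inner_axis') (simp add: inner_vec_def noise_mean_def)
  finally show ?thesis by simp
qed

text \<open>The mean has to be subtracted: with a constraint set or a positive penalty, the
  expectation of \<open>\<eta> \<psi>\<close> need not vanish at the population minimiser.\<close>

definition noise :: "'z \<Rightarrow> real^'d" where "noise z = \<eta> z *\<^sub>R \<psi> z - noise_mean"

lemma noise_meas [measurable]: "noise \<in> borel_measurable M"
  by (simp add: noise_def[abs_def])

text \<open>Centring only lowers second moments, so the bound for \<open>\<eta> \<psi>\<close>
  carries over.\<close>

lemma noise_second_moment:
  "(\<integral>z. (u \<bullet> noise z)\<^sup>2 \<partial>M) \<le> noise_sup * (norm u)\<^sup>2"
  "integrable M (\<lambda>z. (u \<bullet> noise z)\<^sup>2)"
proof -
  have eq: "(u \<bullet> noise z)\<^sup>2 = (u \<bullet> \<psi> z)\<^sup>2 * (\<eta> z)\<^sup>2 - 2 * (u \<bullet> noise_mean) * (\<eta> z * (u \<bullet> \<psi> z)) + (u \<bullet> noise_mean)\<^sup>2" for z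
    by (simp add: noise_def inner_diff_right power2_eq_square algebra_simps)
  have I: "integrable M (\<lambda>z. (u \<bullet> \<psi> z)\<^sup>2 * (\<eta> z)\<^sup>2)"
    using integrable_\<psi>\<psi>\<eta>\<eta>[of u u] by (simp add: power2_eq_square)
  show "integrable M (\<lambda>z. (u \<bullet> noise z)\<^sup>2)" unfolding eq using I integrable_\<eta>\<psi> by simp
  have "(\<integral>z. (u \<bullet> noise z)\<^sup>2 \<partial>M) = (\<integral>z. (u \<bullet> \<psi> z)\<^sup>2 * (\<eta> z)\<^sup>2 \<partial>M) - (u \<bullet> noise_mean)\<^sup>2"
    unfolding eq using I integrable_\<eta>\<psi>
    by (simp add: inner_noise_mean[symmetric] prob_space power2_eq_square)
  also have "\<dots> \<le> (\<integral>z. (u \<bullet> \<psi> z)\<^sup>2 * (\<eta> z)\<^sup>2 \<partial>M)" by simp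
  also have "\<dots> \<le> noise_sup * (norm u)\<^sup>2" by (rule whitened_noise_le)
  finally show "(\<integral>z. (u \<bullet> noise z)\<^sup>2 \<partial>M) \<le> noise_sup * (norm u)\<^sup>2" .
qed

lemma noise_norm:
  "integrable M (\<lambda>z. (norm (noise z))\<^sup>2)" "(\<integral>z. (norm (noise z))\<^sup>2 \<partial>M) \<le> noise_trace"
proof -
  have eq: "(norm (noise z))\<^sup>2 = (norm (\<psi> z))\<^sup>2 * (\<eta> z)\<^sup>2 - 2 * (\<eta> z * (noise_mean \<bullet> \<psi> z)) + (norm noise_mean)\<^sup>2" for z
    unfolding noise_def power2_norm_eq_inner
    by (simp add: inner_diff_left inner_diff_right inner_commute power2_eq_square algebra_simps)
  show "integrable M (\<lambda>z. (norm (noise z))\<^sup>2)" unfolding eq using integrable_\<psi>\<eta>_norm integrable_\<eta>\<psi> by simp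
  have "(\<integral>z. (norm (noise z))\<^sup>2 \<partial>M) = noise_trace - (norm noise_mean)\<^sup>2"
    unfolding eq using integrable_\<psi>\<eta>_norm integrable_\<eta>\<psi>
    by (simp add: inner_noise_mean[symmetric] prob_space power2_norm_eq_inner[of noise_mean] noise_trace_def)
  then show "(\<integral>z. (norm (noise z))\<^sup>2 \<partial>M) \<le> noise_trace" by simp
qed

lemma noise_mean_zero: "(\<integral>z. u \<bullet> noise z \<partial>M) = 0"
  using integrable_\<eta>\<psi>[of u] by (simp add: noise_def inner_diff_right prob_space inner_noise_mean)

lemma noise_trace_nonneg: "0 \<le> noise_trace"
  by (simp add: noise_trace_def)

section \<open>Probability of a good sample\<close>

text \<open>The tail bound with \<open>s = noise_sup\<close>. The constants 15 and 500 are half of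
  the final 30 and 1000, because the excess risk is controlled by twice the squared norm of the
  noise mean.\<close>

lemma eventually_noise_small:
  assumes \<epsilon>: "0 < \<epsilon>" "\<epsilon> < 1"
  shows "\<forall>\<^sub>F n in sequentially.
    measure (PiM {..<n} (\<lambda>_. M)) {\<omega> \<in> space (PiM {..<n} (\<lambda>_. M)).
      15 * noise_trace + 500 * noise_sup * ln (3 / \<epsilon>) < real n * (norm ((\<Sum>i<n. noise (\<omega> i)) /\<^sub>R real n))\<^sup>2} \<le> \<epsilon> / 2"
proof (cases "noise_sup = 0")
  \<comment> \<open>The tail bound requires \<open>s > 0\<close>; a zero supremum forces the noise
    to vanish almost surely.\<close>
  case True
  have "(\<integral>z. (norm (noise z))\<^sup>2 \<partial>M) = (\<integral>z. (\<Sum>j\<in>UNIV. (axis j 1 \<bullet> noise z)\<^sup>2) \<partial>M)"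
    by (simp add: norm_square_eq_sum_axis)
  also have "\<dots> = (\<Sum>j\<in>UNIV. \<integral>z. (axis j 1 \<bullet> noise z)\<^sup>2 \<partial>M)"
    by (intro Bochner_Integration.integral_sum noise_second_moment)
  also have "\<dots> \<le> (\<Sum>j\<in>(UNIV::'d set). 0)"
    using noise_second_moment(1) by (intro sum_mono) (simp add: True)
  finally have "(\<integral>z. (norm (noise z))\<^sup>2 \<partial>M) = 0" by (intro antisym) auto
  then have ae: "AE z in M. noise z = 0"
    using noise_norm(1) by (subst (asm) integral_nonneg_eq_0_iff_AE) auto
  show ?thesis
  proof (rule always_eventually, rule allI)
    fix n :: nat
    let ?N = "PiM {..<n} (\<lambda>_. M)"
    interpret Pn: product_prob_space "\<lambda>_. M" "{..<n}" by unfold_locales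
    have "AE \<omega> in ?N. \<forall>i\<in>{..<n}. noise (\<omega> i) = 0"
      by (intro AE_finite_allI Pn.AE_component ae) auto
    then have "AE \<omega> in ?N. \<not> 15 * noise_trace + 500 * noise_sup * ln (3 / \<epsilon>) < real n * (norm ((\<Sum>i<n. noise (\<omega> i)) /\<^sub>R real n))\<^sup>2"
      by eventually_elim (use noise_trace_nonneg in \<open>simp add: True not_less\<close>)
    then show "measure ?N {\<omega> \<in> space ?N. 15 * noise_trace + 500 * noise_sup * ln (3 / \<epsilon>)
        < real n * (norm ((\<Sum>i<n. noise (\<omega> i)) /\<^sub>R real n))\<^sup>2} \<le> \<epsilon> / 2"
      using \<epsilon> by (subst (asm) AE_iff_measurable[OF _ refl]) (auto simp: measure_def)
  qed
next
  case False
  then have s: "0 < noise_sup" using noise_sup_nonneg by linarith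
  define l where "l = ln (3 / \<epsilon>)"
  have l: "0 < l" and el: "exp (- l) = \<epsilon> / 3" using \<epsilon> by (auto simp: l_def exp_minus)
  let ?t = "15 * noise_trace + 500 * noise_sup * l"
  have t: "0 < ?t" using s l noise_trace_nonneg by (intro add_nonneg_pos) auto
  have "(\<integral>z. (norm (noise z))\<^sup>2 \<partial>M) / (2 * noise_sup) - ?t / (8 * noise_sup)
      \<le> noise_trace / (2 * noise_sup) - ?t / (8 * noise_sup)"
    using s noise_norm(2) by (intro diff_right_mono divide_right_mono) auto
  \<comment> \<open>Here \<open>1/2 - 15/8 = - 11/8\<close> and \<open>500/8 = 125/2\<close>, which
    is far more than the \<open>2 * l\<close> needed to reach
    \<open>2 \<epsilon>^2 / 9 <= \<epsilon> / 2\<close>.\<close>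
  also have "\<dots> = - (11 / 8) * (noise_trace / noise_sup) - 125 / 2 * l" using s by (simp add: field_simps)
  also have "\<dots> \<le> - l + - l" using s l noise_trace_nonneg divide_nonneg_pos[OF noise_trace_nonneg s] by linarith
  finally have "2 * exp ((\<integral>z. (norm (noise z))\<^sup>2 \<partial>M) / (2 * noise_sup) - ?t / (8 * noise_sup)) \<le> 2 * exp (- l + - l)"
    by simp
  also have "\<dots> = 2 * (\<epsilon> / 3 * (\<epsilon> / 3))" by (simp only: exp_add el)
  also have "\<dots> \<le> \<epsilon> / 2" using \<epsilon> mult_left_le[of \<epsilon> \<epsilon>] by simp
  finally have bound: "2 * exp ((\<integral>z. (norm (noise z))\<^sup>2 \<partial>M) / (2 * noise_sup) - ?t / (8 * noise_sup)) \<le> \<epsilon> / 2" .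
  have "\<forall>\<^sub>F n in sequentially. measure (PiM {..<n} (\<lambda>_. M)) {\<omega> \<in> space (PiM {..<n} (\<lambda>_. M)).
      ?t < real n * (norm ((\<Sum>i<n. noise (\<omega> i)) /\<^sub>R real n))\<^sup>2}
     \<le> 2 * exp ((\<integral>z. (norm (noise z))\<^sup>2 \<partial>M) / (2 * noise_sup) - ?t / (8 * noise_sup))"
    by (rule eventually_norm_mean_tail)
       (use prob_space_axioms noise_norm noise_mean_zero s noise_second_moment t in auto)
  then show ?thesis unfolding l_def[symmetric] by eventually_elim (use bound in linarith)
qed

text \<open>The weak law for each entry of the Gram matrix at level \<open>\<delta> / N\<close>,
  followed by a union bound over the \<open>N\<close> index pairs.\<close>

lemma eventually_gram_close:
  assumes \<delta>: "0 < \<delta>" and c: "0 < c"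
  shows "\<forall>\<^sub>F n in sequentially. measure (PiM {..<n} (\<lambda>_. M)) {\<omega> \<in> space (PiM {..<n} (\<lambda>_. M)).
    \<exists>j k. c < \<bar>(\<Sum>i<n. \<psi> (\<omega> i) $ j * \<psi> (\<omega> i) $ k - (\<integral>z. \<psi> z $ j * \<psi> z $ k \<partial>M)) / real n\<bar>} \<le> \<delta>"
proof -
  define f where "f p z = \<psi> z $ fst p * \<psi> z $ snd p - (\<integral>z. \<psi> z $ fst p * \<psi> z $ snd p \<partial>M)" for p :: "'d \<times> 'd" and z
  have m[measurable]: "f p \<in> borel_measurable M" for p by (simp add: f_def[abs_def])
  have ax: "\<psi> z $ j = axis j 1 \<bullet> \<psi> z" for z j by (simp add: inner_axis')
  have i1: "integrable M (\<lambda>z. \<psi> z $ j * \<psi> z $ k)" for j k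
    unfolding ax by (rule integrable_\<psi>\<psi>)
  \<comment> \<open>The fourth moment of \<open>\<Phi>\<close> provides the square integrability of
    the Gram entries.\<close>
  have i2: "integrable M (\<lambda>z. (\<psi> z $ j * \<psi> z $ k)\<^sup>2)" for j k
  proof (rule Bochner_Integration.integrable_bound)
    show "integrable M (\<lambda>z. ((norm (T $ j))\<^sup>2 * (norm (T $ k))\<^sup>2) * norm (\<Phi> z) ^ 4)" using \<Phi>_4 by simp
    show "AE z in M. norm ((\<psi> z $ j * \<psi> z $ k)\<^sup>2) \<le> norm (((norm (T $ j))\<^sup>2 * (norm (T $ k))\<^sup>2) * norm (\<Phi> z) ^ 4)"
    proof (rule AE_I2)
      fix z
      have "\<bar>\<psi> z $ j\<bar> * \<bar>\<psi> z $ k\<bar> \<le> (norm (T $ j) * norm (\<Phi> z)) * (norm (T $ k) * norm (\<Phi> z))"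
        unfolding \<psi>_nth by (intro mult_mono Cauchy_Schwarz_ineq2) auto
      then have "(\<bar>\<psi> z $ j\<bar> * \<bar>\<psi> z $ k\<bar>)\<^sup>2 \<le> ((norm (T $ j) * norm (\<Phi> z)) * (norm (T $ k) * norm (\<Phi> z)))\<^sup>2"
        by (rule power_mono) auto
      then have "(\<psi> z $ j * \<psi> z $ k)\<^sup>2 \<le> ((norm (T $ j))\<^sup>2 * (norm (T $ k))\<^sup>2) * norm (\<Phi> z) ^ 4"
        by (simp add: power_mult_distrib power2_eq_square power4_eq_xxxx algebra_simps)
      then show "norm ((\<psi> z $ j * \<psi> z $ k)\<^sup>2) \<le> norm (((norm (T $ j))\<^sup>2 * (norm (T $ k))\<^sup>2) * norm (\<Phi> z) ^ 4)"
        by simp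
    qed
  qed simp
  have f2: "integrable M (\<lambda>z. (f p z)\<^sup>2)" for p
  proof -
    have "(f p z)\<^sup>2 = (\<psi> z $ fst p * \<psi> z $ snd p)\<^sup>2 - 2 * (\<integral>z. \<psi> z $ fst p * \<psi> z $ snd p \<partial>M) * (\<psi> z $ fst p * \<psi> z $ snd p)
        + (\<integral>z. \<psi> z $ fst p * \<psi> z $ snd p \<partial>M)\<^sup>2" for z
      by (simp add: f_def power2_diff algebra_simps)
    then show ?thesis using i1 i2 by simp
  qed
  have f0: "(\<integral>z. f p z \<partial>M) = 0" for p using i1 by (simp add: f_def prob_space)
  define N where "N = real (card (UNIV :: ('d \<times> 'd) set))"
  have N: "0 < N" by (simp add: N_def card_gt_0_iff)
  have "\<forall>\<^sub>F n in sequentially. measure (PiM {..<n} (\<lambda>_. M))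
      {\<omega> \<in> space (PiM {..<n} (\<lambda>_. M)). c < \<bar>(\<Sum>i<n. f p (\<omega> i)) / real n\<bar>} \<le> \<delta> / N" for p
    using \<delta> N by (intro eventually_mean_deviation_small prob_space_axioms m f2 f0 c) simp
  then have "\<forall>\<^sub>F n in sequentially. \<forall>p\<in>UNIV. measure (PiM {..<n} (\<lambda>_. M))
      {\<omega> \<in> space (PiM {..<n} (\<lambda>_. M)). c < \<bar>(\<Sum>i<n. f p (\<omega> i)) / real n\<bar>} \<le> \<delta> / N"
    by (intro eventually_ball_finite) auto
  then show ?thesis
  proof eventually_elim
    case (elim n)
    let ?N = "PiM {..<n} (\<lambda>_. M)"
    interpret Pn: prob_space ?N by (intro prob_space_PiM prob_space_axioms)
    let ?B = "\<lambda>p. {\<omega> \<in> space ?N. c < \<bar>(\<Sum>i<n. f p (\<omega> i)) / real n\<bar>}"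
    have "{\<omega> \<in> space ?N. \<exists>j k. c < \<bar>(\<Sum>i<n. \<psi> (\<omega> i) $ j * \<psi> (\<omega> i) $ k - (\<integral>z. \<psi> z $ j * \<psi> z $ k \<partial>M)) / real n\<bar>} = (\<Union>p. ?B p)"
      by (simp add: f_def set_eq_iff)
    also have "Pn.prob \<dots> \<le> (\<Sum>p\<in>UNIV. Pn.prob (?B p))"
      by (rule Pn.finite_measure_subadditive_finite) auto
    also have "\<dots> \<le> (\<Sum>p\<in>(UNIV :: ('d \<times> 'd) set). \<delta> / N)" using elim by (intro sum_mono) auto
    also have "\<dots> = \<delta>" using N by (simp add: N_def)
    finally show ?case .
  qed
qed

text \<open>The deterministic conditions that imply the risk bound. The entrywise tolerance
  \<open>1 / (4 d)\<close>, with \<open>d\<close> the dimension, is what keeps the error of the Gram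
  quadratic form below a quarter of the squared norm.\<close>

definition good_sample :: "nat \<Rightarrow> real \<Rightarrow> (nat \<Rightarrow> 'z) \<Rightarrow> bool" where
  "good_sample n b \<omega> \<longleftrightarrow> (\<forall>i<n. \<Phi> (\<omega> i) = S *v \<psi> (\<omega> i))
     \<and> real n * (norm ((\<Sum>i<n. noise (\<omega> i)) /\<^sub>R real n))\<^sup>2 \<le> b
     \<and> (\<forall>j k. \<bar>(\<Sum>i<n. \<psi> (\<omega> i) $ j * \<psi> (\<omega> i) $ k - (\<integral>z. \<psi> z $ j * \<psi> z $ k \<partial>M)) / real n\<bar> \<le> 1 / (4 * real CARD('d)))"

text \<open>The Gram and noise conditions may each fail with probability
  \<open>\<epsilon> / 2\<close>; the recovery of \<open>\<Phi>\<close> from \<open>\<psi>\<close> at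
  the sample points costs only a null set.\<close>

lemma eventually_good_sample:
  assumes \<epsilon>: "0 < \<epsilon>" "\<epsilon> < 1"
  shows "\<forall>\<^sub>F n in sequentially. \<exists>A\<in>sets (PiM {..<n} (\<lambda>_. M)). 1 - \<epsilon> \<le> measure (PiM {..<n} (\<lambda>_. M)) A
    \<and> (\<forall>\<omega>\<in>A. good_sample n (15 * noise_trace + 500 * noise_sup * ln (3 / \<epsilon>)) \<omega>)"
proof -
  let ?b = "15 * noise_trace + 500 * noise_sup * ln (3 / \<epsilon>)" and ?c = "1 / (4 * real CARD('d))"
  have "0 < \<epsilon> / 2" "0 < ?c" using \<epsilon> by auto
  from eventually_gram_close[OF this] eventually_noise_small[OF \<epsilon>]
  show ?thesis
  proof eventually_elim
    case (elim n)
    let ?N = "PiM {..<n} (\<lambda>_. M)"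
    interpret Pn: product_prob_space "\<lambda>_. M" "{..<n}" by unfold_locales
    let ?B1 = "{\<omega> \<in> space ?N. \<exists>j k. ?c < \<bar>(\<Sum>i<n. \<psi> (\<omega> i) $ j * \<psi> (\<omega> i) $ k - (\<integral>z. \<psi> z $ j * \<psi> z $ k \<partial>M)) / real n\<bar>}"
    let ?B2 = "{\<omega> \<in> space ?N. ?b < real n * (norm ((\<Sum>i<n. noise (\<omega> i)) /\<^sub>R real n))\<^sup>2}"
    have B1: "?B1 \<in> sets ?N" and B2: "?B2 \<in> sets ?N" by measurable
    have "AE \<omega> in ?N. \<forall>i\<in>{..<n}. \<Phi> (\<omega> i) = S *v \<psi> (\<omega> i)"
      by (intro AE_finite_allI Pn.AE_component AE_\<Phi>_eq) auto
    then obtain B3 where null: "B3 \<in> null_sets ?N"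
      and B3': "\<And>\<omega>. \<omega> \<in> space ?N - B3 \<Longrightarrow> \<forall>i\<in>{..<n}. \<Phi> (\<omega> i) = S *v \<psi> (\<omega> i)"
      by (rule AE_E3) blast
    then have B3: "B3 \<in> sets ?N" "Pn.P.prob B3 = 0"
      by (auto simp: measure_eq_0_null_sets)
    let ?A = "space ?N - (?B1 \<union> ?B2 \<union> B3)"
    have "Pn.P.prob (?B1 \<union> ?B2 \<union> B3) \<le> Pn.P.prob (?B1 \<union> ?B2) + Pn.P.prob B3"
      using B1 B2 B3 by (intro measure_Un_le) auto
    also have "\<dots> \<le> Pn.P.prob ?B1 + Pn.P.prob ?B2"
      using B1 B2 B3(2) measure_Un_le[of ?B1 ?N ?B2] by simp
    also have "\<dots> \<le> \<epsilon>" using elim by simp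
    finally have "1 - \<epsilon> \<le> Pn.P.prob ?A"
      using B1 B2 B3 by (subst Pn.P.prob_compl) auto
    moreover have "good_sample n ?b \<omega>" if "\<omega> \<in> ?A" for \<omega>
      using that B3'[of \<omega>] unfolding good_sample_def by (auto simp: not_less)
    ultimately show ?case using B1 B2 B3 by (intro bexI[of _ ?A]) auto
  qed
qed

section \<open>Deterministic analysis on a good sample\<close>

text \<open>The entrywise errors add up to at most the square of the sum of the
  \<open>|y $ j|\<close> over \<open>4 d\<close>, which Cauchy-Schwarz reduces to a quarter of the
  squared norm.\<close>

lemma gram_lower_bound:
  assumes "good_sample n b \<omega>" "0 < n"
  shows "(\<integral>z. (y \<bullet> \<psi> z)\<^sup>2 \<partial>M) - (norm y)\<^sup>2 / 4 \<le> (\<Sum>i<n. (y \<bullet> \<psi> (\<omega> i))\<^sup>2) / real n"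
proof -
  define G where "G j k = (\<Sum>i<n. \<psi> (\<omega> i) $ j * \<psi> (\<omega> i) $ k - (\<integral>z. \<psi> z $ j * \<psi> z $ k \<partial>M)) / real n" for j k
  define d where "d = real CARD('d)"
  have d: "d > 0" by (simp add: d_def)
  have G: "\<bar>G j k\<bar> \<le> 1 / (4 * d)" for j k
    using assms(1) unfolding good_sample_def G_def d_def by blast
  have "(\<Sum>j\<in>UNIV. \<Sum>k\<in>UNIV. y $ j * y $ k * G j k)
      = (\<Sum>i<n. \<Sum>j\<in>UNIV. \<Sum>k\<in>UNIV. y $ j * y $ k * (\<psi> (\<omega> i) $ j * \<psi> (\<omega> i) $ k)) / real n
        - (\<Sum>j\<in>UNIV. \<Sum>k\<in>UNIV. y $ j * y $ k * (\<integral>z. \<psi> z $ j * \<psi> z $ k \<partial>M))"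
  proof -
    have "G j k = (\<Sum>i<n. \<psi> (\<omega> i) $ j * \<psi> (\<omega> i) $ k) / real n - (\<integral>z. \<psi> z $ j * \<psi> z $ k \<partial>M)" for j k
      using assms(2) by (simp add: G_def sum_subtractf diff_divide_distrib)
    then have "(\<Sum>j\<in>UNIV. \<Sum>k\<in>UNIV. y $ j * y $ k * G j k)
       = (\<Sum>j\<in>UNIV. \<Sum>k\<in>UNIV. \<Sum>i<n. y $ j * y $ k * (\<psi> (\<omega> i) $ j * \<psi> (\<omega> i) $ k)) / real n
         - (\<Sum>j\<in>UNIV. \<Sum>k\<in>UNIV. y $ j * y $ k * (\<integral>z. \<psi> z $ j * \<psi> z $ k \<partial>M))"
      by (simp add: right_diff_distrib sum_subtractf sum_distrib_left sum_divide_distrib)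
    also have "(\<Sum>j\<in>UNIV. \<Sum>k\<in>UNIV. \<Sum>i<n. y $ j * y $ k * (\<psi> (\<omega> i) $ j * \<psi> (\<omega> i) $ k))
       = (\<Sum>j\<in>UNIV. \<Sum>i<n. \<Sum>k\<in>UNIV. y $ j * y $ k * (\<psi> (\<omega> i) $ j * \<psi> (\<omega> i) $ k))"
      by (rule sum.cong[OF refl]) (rule sum.swap)
    also have "\<dots> = (\<Sum>i<n. \<Sum>j\<in>UNIV. \<Sum>k\<in>UNIV. y $ j * y $ k * (\<psi> (\<omega> i) $ j * \<psi> (\<omega> i) $ k))"
      by (rule sum.swap)
    finally show ?thesis .
  qed
  also have "(\<lambda>i. \<Sum>j\<in>UNIV. \<Sum>k\<in>UNIV. y $ j * y $ k * (\<psi> (\<omega> i) $ j * \<psi> (\<omega> i) $ k)) = (\<lambda>i. (y \<bullet> \<psi> (\<omega> i))\<^sup>2)"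
    unfolding power2_eq_square inner_vec_def sum_product by (simp add: algebra_simps)
  also have "(\<Sum>j\<in>UNIV. \<Sum>k\<in>UNIV. y $ j * y $ k * (\<integral>z. \<psi> z $ j * \<psi> z $ k \<partial>M)) = (\<integral>z. (y \<bullet> \<psi> z)\<^sup>2 \<partial>M)"
    using inner_second_moment[OF \<psi>_meas integrable_\<psi>_norm, of y y]
    unfolding power2_eq_square by (simp add: inner_vec_def[of y] matrix_vector_mult_def sum_distrib_left algebra_simps)
  finally have eq: "(\<Sum>j\<in>UNIV. \<Sum>k\<in>UNIV. y $ j * y $ k * G j k)
      = (\<Sum>i<n. (y \<bullet> \<psi> (\<omega> i))\<^sup>2) / real n - (\<integral>z. (y \<bullet> \<psi> z)\<^sup>2 \<partial>M)" .
  have "\<bar>\<Sum>j\<in>UNIV. \<Sum>k\<in>UNIV. y $ j * y $ k * G j k\<bar> \<le> (\<Sum>j\<in>UNIV. \<Sum>k\<in>UNIV. \<bar>y $ j\<bar> * \<bar>y $ k\<bar> * (1 / (4 * d)))"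
    by (intro order_trans[OF sum_abs] sum_mono) (use mult_left_mono[OF G] in \<open>simp add: abs_mult\<close>)
  also have "\<dots> = (\<Sum>j\<in>UNIV. \<bar>y $ j\<bar>)\<^sup>2 / (4 * d)"
    by (simp add: power2_eq_square sum_product sum_divide_distrib)
  also have "\<dots> \<le> ((\<Sum>j\<in>UNIV. \<bar>y $ j\<bar>\<^sup>2) * d) / (4 * d)"
    using d sum_squared_le_sum_of_squares[of "\<lambda>j. \<bar>y $ j\<bar>" UNIV]
    by (intro divide_right_mono) (auto simp: d_def)
  also have "\<dots> = (norm y)\<^sup>2 / 4"
    using d by (simp add: power2_norm_eq_inner) (simp add: inner_vec_def power2_eq_square)
  finally show ?thesis unfolding eq by linarith
qed

text \<open>Along the segment from \<open>\<theta>t\<close> to \<open>\<theta>h\<close> the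
  empirical objective is a quadratic minimal at its right end, so \<open>2 k + g <= 0\<close>. The
  population excess is \<open>g' + |y|^2\<close>; the two linear terms differ by
  \<open>2 (y . Z)\<close>, and \<open>k\<close> retains three quarters of
  \<open>|y|^2\<close>.\<close>

lemma excess_risk_le:
  assumes good: "good_sample n b \<omega>" and n: "0 < n"
    and \<Theta>: "convex \<Theta>" "\<theta>t \<in> \<Theta>" "\<theta>h \<in> \<Theta>"
    and min: "\<And>\<theta>. \<theta> \<in> \<Theta> \<Longrightarrow>
      (\<Sum>i<n. (\<eta> (\<omega> i) + (\<theta>h - \<theta>t) \<bullet> \<Phi> (\<omega> i))\<^sup>2) / real n + lam * (norm \<theta>h)\<^sup>2
      \<le> (\<Sum>i<n. (\<eta> (\<omega> i) + (\<theta> - \<theta>t) \<bullet> \<Phi> (\<omega> i))\<^sup>2) / real n + lam * (norm \<theta>)\<^sup>2"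
  shows "(\<integral>z. (\<eta> z + (\<theta>h - \<theta>t) \<bullet> \<Phi> z)\<^sup>2 \<partial>M) + lam * (norm \<theta>h)\<^sup>2
    \<le> (\<integral>z. (\<eta> z)\<^sup>2 \<partial>M) + lam * (norm \<theta>t)\<^sup>2 + 2 * b / real n"
proof -
  define \<delta> where "\<delta> = \<theta>h - \<theta>t"
  define y where "y = S *v \<delta>"
  define Z where "Z = (\<Sum>i<n. noise (\<omega> i)) /\<^sub>R real n"
  \<comment> \<open>\<open>g\<close> and \<open>k\<close> are the linear and quadratic coefficients
    of the empirical objective in \<open>s\<close>; \<open>g'\<close> is the population counterpart
    of \<open>g\<close>.\<close>
  define g where "g = 2 * ((\<Sum>i<n. \<eta> (\<omega> i) * (\<delta> \<bullet> \<Phi> (\<omega> i))) / real n) + 2 * lam * (\<theta>t \<bullet> \<delta>)"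
  define k where "k = (\<Sum>i<n. (\<delta> \<bullet> \<Phi> (\<omega> i))\<^sup>2) / real n + lam * (norm \<delta>)\<^sup>2"
  define g' where "g' = 2 * (\<integral>z. \<eta> z * (\<delta> \<bullet> \<Phi> z) \<partial>M) + 2 * lam * (\<theta>t \<bullet> \<delta>)"
  have norm_exp: "(norm (\<theta>t + s *\<^sub>R \<delta>))\<^sup>2 = (norm \<theta>t)\<^sup>2 + s * (2 * (\<theta>t \<bullet> \<delta>)) + s\<^sup>2 * (norm \<delta>)\<^sup>2" for s
    unfolding power2_norm_eq_inner by (simp add: inner_add_left inner_add_right inner_commute power2_eq_square algebra_simps)
  have emp: "(\<Sum>i<n. (\<eta> (\<omega> i) + (s *\<^sub>R \<delta>) \<bullet> \<Phi> (\<omega> i))\<^sup>2) / real n + lam * (norm (\<theta>t + s *\<^sub>R \<delta>))\<^sup>2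
     = ((\<Sum>i<n. (\<eta> (\<omega> i))\<^sup>2) / real n + lam * (norm \<theta>t)\<^sup>2) + s * g + s\<^sup>2 * k" for s
  proof -
    have "(\<Sum>i<n. (\<eta> (\<omega> i) + (s *\<^sub>R \<delta>) \<bullet> \<Phi> (\<omega> i))\<^sup>2)
       = (\<Sum>i<n. (\<eta> (\<omega> i))\<^sup>2) + 2 * s * (\<Sum>i<n. \<eta> (\<omega> i) * (\<delta> \<bullet> \<Phi> (\<omega> i))) + s\<^sup>2 * (\<Sum>i<n. (\<delta> \<bullet> \<Phi> (\<omega> i))\<^sup>2)"
      by (simp add: power2_sum power_mult_distrib sum.distrib sum_distrib_left algebra_simps)
    then show ?thesis
      unfolding norm_exp g_def k_def by (simp add: add_divide_distrib algebra_simps)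
  qed
  have "2 * k + g \<le> 0"
  proof (rule quadratic_min_at_right_end)
    fix s :: real assume s: "0 \<le> s" "s \<le> 1"
    have "\<theta>t + s *\<^sub>R \<delta> = (1 - s) *\<^sub>R \<theta>t + s *\<^sub>R \<theta>h" by (simp add: \<delta>_def algebra_simps)
    also have "\<dots> \<in> \<Theta>" using \<Theta> s by (auto simp: convex_alt)
    finally have "\<theta>t + s *\<^sub>R \<delta> \<in> \<Theta>" .
    from min[OF this] emp[of s] emp[of 1]
    show "((\<Sum>i<n. (\<eta> (\<omega> i))\<^sup>2) / real n + lam * (norm \<theta>t)\<^sup>2) + g + k
        \<le> ((\<Sum>i<n. (\<eta> (\<omega> i))\<^sup>2) / real n + lam * (norm \<theta>t)\<^sup>2) + s * g + s\<^sup>2 * k"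
      by (simp add: \<delta>_def)
  qed
  have inn: "\<delta> \<bullet> (S *v w) = y \<bullet> w" for w
    unfolding y_def by (metis transpose_S dot_lmul_matrix transpose_matrix_vector)
  have sample: "\<delta> \<bullet> \<Phi> (\<omega> i) = y \<bullet> \<psi> (\<omega> i)" if "i < n" for i
  proof -
    have "\<Phi> (\<omega> i) = S *v \<psi> (\<omega> i)" using good that by (auto simp: good_sample_def)
    then have "\<delta> \<bullet> \<Phi> (\<omega> i) = \<delta> \<bullet> (S *v \<psi> (\<omega> i))" by (rule arg_cong)
    then show ?thesis by (simp add: inn)
  qed
  have ae: "AE z in M. \<delta> \<bullet> \<Phi> z = y \<bullet> \<psi> z"
    using AE_\<Phi>_eq by eventually_elim (metis inn)
  have y2: "(norm y)\<^sup>2 = (\<integral>z. (\<delta> \<bullet> \<Phi> z)\<^sup>2 \<partial>M) + lam * (norm \<delta>)\<^sup>2" unfolding y_def by (rule norm_S)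
  have k: "3 / 4 * (norm y)\<^sup>2 \<le> k"
  proof -
    have "(\<integral>z. (y \<bullet> \<psi> z)\<^sup>2 \<partial>M) = (\<integral>z. (\<delta> \<bullet> \<Phi> z)\<^sup>2 \<partial>M)"
      using ae by (intro integral_cong_AE) auto
    moreover have "(\<Sum>i<n. (y \<bullet> \<psi> (\<omega> i))\<^sup>2) = (\<Sum>i<n. (\<delta> \<bullet> \<Phi> (\<omega> i))\<^sup>2)" using sample by simp
    ultimately have "(\<integral>z. (\<delta> \<bullet> \<Phi> z)\<^sup>2 \<partial>M) - (norm y)\<^sup>2 / 4 \<le> k - lam * (norm \<delta>)\<^sup>2"
      using gram_lower_bound[OF good n, of y] by (simp add: k_def)
    \<comment> \<open>\<open>I\<close> stands for the prediction part and \<open>J\<close> for the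
      penalty part of \<open>|y|^2 = I + J\<close>; the penalty is the same in both
      objectives.\<close>
    moreover have "3 / 4 * (I + J) \<le> K" if "I - (I + J) / 4 \<le> K - J" for I J K :: real
      using that by (simp add: field_simps)
    ultimately show ?thesis unfolding y2 by blast
  qed
  have "y \<bullet> Z = (\<Sum>i<n. \<eta> (\<omega> i) * (\<delta> \<bullet> \<Phi> (\<omega> i))) / real n - (\<integral>z. \<eta> z * (\<delta> \<bullet> \<Phi> z) \<partial>M)"
  proof -
    have "(\<integral>z. \<eta> z * (y \<bullet> \<psi> z) \<partial>M) = (\<integral>z. \<eta> z * (\<delta> \<bullet> \<Phi> z) \<partial>M)"
      using ae by (intro integral_cong_AE) auto
    moreover have "y \<bullet> Z = (\<Sum>i<n. \<eta> (\<omega> i) * (\<delta> \<bullet> \<Phi> (\<omega> i)) - y \<bullet> noise_mean) / real n"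
      using sample by (simp add: Z_def inner_sum_right noise_def inner_diff_right divide_inverse_commute)
    ultimately show ?thesis using n
      by (simp add: inner_noise_mean sum_subtractf diff_divide_distrib)
  qed
  then have "g' - g = - 2 * (y \<bullet> Z)" by (simp add: g_def g'_def)
  also have "\<dots> \<le> 2 * (norm y * norm Z)" using Cauchy_Schwarz_ineq2[of y Z] by linarith
  finally have "g' + (norm y)\<^sup>2 \<le> 2 * (norm y * norm Z) - (norm y)\<^sup>2 / 2"
    using k \<open>2 * k + g \<le> 0\<close> by linarith
  \<comment> \<open>Maximisation over \<open>norm y\<close>, attained at
    \<open>norm y = 2 * norm Z\<close>.\<close>
  also have "\<dots> \<le> 2 * (norm Z)\<^sup>2"
    using zero_le_power2[of "norm y - 2 * norm Z"] by (simp add: power2_eq_square algebra_simps)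
  also have "\<dots> \<le> 2 * (b / real n)"
    using good n by (simp add: good_sample_def Z_def[symmetric] pos_le_divide_eq mult.commute)
  finally have bound: "g' + (norm y)\<^sup>2 \<le> 2 * b / real n" by simp
  have "(\<integral>z. (\<eta> z + (\<theta>h - \<theta>t) \<bullet> \<Phi> z)\<^sup>2 \<partial>M)
      = (\<integral>z. (\<eta> z)\<^sup>2 + 2 * (\<eta> z * (\<delta> \<bullet> \<Phi> z)) + (\<delta> \<bullet> \<Phi> z) * (\<delta> \<bullet> \<Phi> z) \<partial>M)"
    by (simp add: \<delta>_def power2_eq_square algebra_simps)
  also have "\<dots> = (\<integral>z. (\<eta> z)\<^sup>2 \<partial>M) + 2 * (\<integral>z. \<eta> z * (\<delta> \<bullet> \<Phi> z) \<partial>M) + (\<integral>z. (\<delta> \<bullet> \<Phi> z)\<^sup>2 \<partial>M)"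
    using \<eta>_sq integrable_\<eta>\<Phi> integrable_\<Phi>\<Phi> by (simp add: power2_eq_square)
  finally have risk: "(\<integral>z. (\<eta> z + (\<theta>h - \<theta>t) \<bullet> \<Phi> z)\<^sup>2 \<partial>M) = \<dots>" .
  have "\<theta>t + 1 *\<^sub>R \<delta> = \<theta>h" by (simp add: \<delta>_def)
  then have "(norm \<theta>h)\<^sup>2 = (norm \<theta>t)\<^sup>2 + 2 * (\<theta>t \<bullet> \<delta>) + (norm \<delta>)\<^sup>2"
    using norm_exp[of 1] by simp
  then have "(\<integral>z. (\<eta> z + (\<theta>h - \<theta>t) \<bullet> \<Phi> z)\<^sup>2 \<partial>M) + lam * (norm \<theta>h)\<^sup>2
      = (\<integral>z. (\<eta> z)\<^sup>2 \<partial>M) + lam * (norm \<theta>t)\<^sup>2 + (g' + (norm y)\<^sup>2)"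
    unfolding risk y2 g'_def by (simp add: algebra_simps)
  then show ?thesis using bound by linarith
qed

section \<open>The noise terms against the dimension and the conditional variance\<close>

text \<open>The denominator is the effective dimension itself. If it is zero, \<open>\<psi>\<close>
  vanishes almost surely and so does the trace, in agreement with division by zero giving 0.\<close>

lemma noise_trace_div_mult_eff_dim:
  "noise_trace / (\<integral>z. (norm (\<psi> z))\<^sup>2 \<partial>M) * eff_dim = noise_trace"
proof (cases "(\<integral>z. (norm (\<psi> z))\<^sup>2 \<partial>M) = 0")
  case True
  then have "AE z in M. (norm (\<psi> z))\<^sup>2 = 0"
    using integrable_\<psi>_norm by (simp add: integral_nonneg_eq_0_iff_AE)
  then have "noise_trace = (\<integral>z. 0 \<partial>M)" unfolding noise_trace_def by (intro integral_cong_AE) auto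
  then show ?thesis by simp
next
  case False
  then show ?thesis by (simp add: eff_dim_eq)
qed

lemma eff_dim_nonneg: "0 \<le> eff_dim"
  by (simp add: eff_dim_eq)

text \<open>A nonnegative weight \<open>h\<close> measurable with respect to \<open>F\<close> may be
  moved through the conditional expectation, so \<open>h \<eta>^2\<close> has integral at most
  \<open>c\<close> times that of \<open>h\<close>. The weights are the squared norm of
  \<open>\<psi>\<close> and the squares \<open>(v . \<Phi>)^2\<close>.\<close>

lemma noise_bounds_of_conditional_variance:
  assumes F: "subalgebra M F" and \<Phi>F: "\<Phi> \<in> borel_measurable F" and c: "0 \<le> c"
    and bd: "AE z in M. nn_cond_exp M F (\<lambda>z. ennreal ((\<eta> z)\<^sup>2)) z \<le> ennreal c"
  shows "noise_trace \<le> c * (\<integral>z. (norm (\<psi> z))\<^sup>2 \<partial>M)" "noise_sup \<le> c"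
proof -
  interpret finite_measure_subalgebra M F by unfold_locales (rule F)
  have main: "(\<integral>z. h z * (\<eta> z)\<^sup>2 \<partial>M) \<le> c * (\<integral>z. h z \<partial>M)"
    if h: "h \<in> borel_measurable F" "\<And>z. 0 \<le> h z" "integrable M h" "integrable M (\<lambda>z. h z * (\<eta> z)\<^sup>2)" for h
  proof -
    have [measurable]: "h \<in> borel_measurable M" using h(3) by simp
    have "ennreal (\<integral>z. h z * (\<eta> z)\<^sup>2 \<partial>M) = (\<integral>\<^sup>+z. ennreal (h z) * ennreal ((\<eta> z)\<^sup>2) \<partial>M)"
      using h by (subst nn_integral_eq_integral[symmetric]) (auto simp: ennreal_mult)
    also have "\<dots> = (\<integral>\<^sup>+z. ennreal (h z) * nn_cond_exp M F (\<lambda>z. ennreal ((\<eta> z)\<^sup>2)) z \<partial>M)"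
      using h(1) by (intro nn_cond_exp_intg[symmetric]) auto
    also have "\<dots> \<le> (\<integral>\<^sup>+z. ennreal (c * h z) \<partial>M)"
      using bd by (intro nn_integral_mono_AE, eventually_elim)
        (simp add: ennreal_mult c h(2) mult.commute[of "ennreal c"] mult_left_mono)
    also have "\<dots> = ennreal (c * (\<integral>z. h z \<partial>M))"
      using h c by (subst nn_integral_eq_integral) auto
    finally show ?thesis using c h(2) by (subst (asm) ennreal_le_iff) (auto intro!: mult_nonneg_nonneg)
  qed
  have \<psi>F: "\<psi> \<in> borel_measurable F"
  proof -
    have "(\<lambda>z. T *v \<Phi> z) \<in> borel_measurable F"
      by (rule borel_measurable_continuous_on[OF _ \<Phi>F])
         (intro linear_continuous_on linear_conv_bounded_linear[THEN iffD1] matrix_vector_mul_linear)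
    then show ?thesis by (simp add: \<psi>_def[abs_def])
  qed
  show "noise_trace \<le> c * (\<integral>z. (norm (\<psi> z))\<^sup>2 \<partial>M)"
    unfolding noise_trace_def using \<psi>F
    by (intro main integrable_\<psi>_norm integrable_\<psi>\<eta>_norm) auto
  show "noise_sup \<le> c"
    unfolding noise_sup_def
  proof (rule cSUP_least)
    fix v
    have i: "integrable M (\<lambda>z. (v \<bullet> \<Phi> z)\<^sup>2)" "integrable M (\<lambda>z. (v \<bullet> \<Phi> z)\<^sup>2 * (\<eta> z)\<^sup>2)"
      using integrable_\<Phi>\<Phi>[of v v] integrable_\<Phi>\<Phi>\<eta>\<eta>[of v v] by (simp_all add: power2_eq_square)
    have "(\<integral>z. (v \<bullet> \<Phi> z)\<^sup>2 * (\<eta> z)\<^sup>2 \<partial>M) \<le> c * (\<integral>z. (v \<bullet> \<Phi> z)\<^sup>2 \<partial>M)"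
      using \<Phi>F i by (intro main) auto
    also have "\<dots> \<le> c * ((\<integral>z. (v \<bullet> \<Phi> z)\<^sup>2 \<partial>M) + lam * (norm v)\<^sup>2)"
      using c lam_nonneg by (intro mult_left_mono) auto
    finally have *: "(\<integral>z. (v \<bullet> \<Phi> z)\<^sup>2 * (\<eta> z)\<^sup>2 \<partial>M) \<le> c * ((\<integral>z. (v \<bullet> \<Phi> z)\<^sup>2 \<partial>M) + lam * (norm v)\<^sup>2)" .
    have "0 \<le> (\<integral>z. (v \<bullet> \<Phi> z)\<^sup>2 \<partial>M) + lam * (norm v)\<^sup>2" using lam_nonneg by simp
    then show "(\<integral>z. (v \<bullet> \<Phi> z)\<^sup>2 * (\<eta> z)\<^sup>2 \<partial>M) / ((\<integral>z. (v \<bullet> \<Phi> z)\<^sup>2 \<partial>M) + lam * (norm v)\<^sup>2) \<le> c"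
      using * c by (cases "(\<integral>z. (v \<bullet> \<Phi> z)\<^sup>2 \<partial>M) + lam * (norm v)\<^sup>2 = 0") (auto simp: divide_le_eq)
  qed simp
qed

end

section \<open>The risk bound\<close>

text \<open>The event \<open>A\<close> is chosen before \<open>\<theta>h\<close>, so it serves all
  empirical minimisers at once. The essential supremum lives in \<open>ereal\<close> because it may
  be infinite.\<close>

theorem theorem2p1:
  fixes MX :: "'x measure"
    and P :: "('x \<times> real) measure"
    and \<phi> :: "'x \<Rightarrow> real^'d"
    and \<Theta> :: "(real^'d) set"
    and lam :: real
    and \<theta>t :: "real^'d"
  defines "R \<equiv> (\<lambda>\<theta>::real^'d. \<integral>z. (snd z - \<theta> \<bullet> \<phi> (fst z))\<^sup>2 \<partial>P)"
    and "r \<equiv> (\<lambda>(n::nat) (\<omega>::nat \<Rightarrow> 'x \<times> real) (\<theta>::real^'d).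
               (\<Sum>i<n. (\<theta> \<bullet> \<phi> (fst (\<omega> i)) - snd (\<omega> i))\<^sup>2) / real n)"
    and "Q \<equiv> (\<chi> i j. \<integral>z. \<phi> (fst z) $ i * \<phi> (fst z) $ j \<partial>P) :: real^'d^'d"
  defines "Qlam \<equiv> Q + lam *\<^sub>R mat 1"
  defines "D \<equiv> (\<Sum>\<^sub># (image_mset (\<lambda>\<nu>. if \<nu> > 0 then \<nu> / (\<nu> + lam) else 0)
                          (eigenvalues_mset Q)))"
  assumes P: "prob_space P"
    and sets_P: "sets P = sets (MX \<Otimes>\<^sub>M (borel :: real measure))"
    and \<phi>_meas: "\<phi> \<in> borel_measurable MX"
    and Y_sq: "integrable P (\<lambda>z. (snd z)\<^sup>2)"
    and \<phi>_sq: "\<And>j. integrable P (\<lambda>z. (\<phi> (fst z) $ j)\<^sup>2)"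
    and \<Theta>_closed: "closed \<Theta>" and \<Theta>_convex: "convex \<Theta>"
    and lam_nonneg: "lam \<ge> 0"
    and \<theta>t_in: "\<theta>t \<in> \<Theta>"
    and \<theta>t_min: "\<And>\<theta>. \<theta> \<in> \<Theta> \<Longrightarrow> R \<theta>t + lam * (norm \<theta>t)\<^sup>2 \<le> R \<theta> + lam * (norm \<theta>)\<^sup>2"
    and moment4: "integrable P (\<lambda>z. (norm (\<phi> (fst z))) ^ 4)"
    and moment_noise: "integrable P (\<lambda>z. (norm (\<phi> (fst z)))\<^sup>2 * (\<theta>t \<bullet> \<phi> (fst z) - snd z)\<^sup>2)"
  shows "\<forall>\<epsilon>>0. \<exists>N::nat. \<forall>n\<ge>N.
     (\<exists>A \<in> sets (PiM {..<n} (\<lambda>_. P)).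
        measure (PiM {..<n} (\<lambda>_. P)) A \<ge> 1 - \<epsilon> \<and>
        (\<forall>\<omega>\<in>A. \<forall>\<theta>h.
           (\<theta>h \<in> \<Theta> \<and> (\<forall>\<theta>\<in>\<Theta>. r n \<omega> \<theta>h + lam * (norm \<theta>h)\<^sup>2 \<le> r n \<omega> \<theta> + lam * (norm \<theta>)\<^sup>2))
           \<longrightarrow>
           R \<theta>h + lam * (norm \<theta>h)\<^sup>2
             \<le> (INF \<theta>\<in>\<Theta>. R \<theta> + lam * (norm \<theta>)\<^sup>2)
               + 30 * (\<integral>z. (norm (inv_sqrt_mat Qlam *v \<phi> (fst z)))\<^sup>2
                                * (\<theta>t \<bullet> \<phi> (fst z) - snd z)\<^sup>2 \<partial>P)
                    / (\<integral>z. (norm (inv_sqrt_mat Qlam *v \<phi> (fst z)))\<^sup>2 \<partial>P) * D / real n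
               + 1000 * (SUP v::real^'d.
                     (\<integral>z. (v \<bullet> \<phi> (fst z))\<^sup>2 * (\<theta>t \<bullet> \<phi> (fst z) - snd z)\<^sup>2 \<partial>P)
                     / ((\<integral>z. (v \<bullet> \<phi> (fst z))\<^sup>2 \<partial>P) + lam * (norm v)\<^sup>2))
                  * ln (3 / \<epsilon>) / real n
           \<and>
           ereal ((INF \<theta>\<in>\<Theta>. R \<theta> + lam * (norm \<theta>)\<^sup>2)
               + 30 * (\<integral>z. (norm (inv_sqrt_mat Qlam *v \<phi> (fst z)))\<^sup>2
                                * (\<theta>t \<bullet> \<phi> (fst z) - snd z)\<^sup>2 \<partial>P)
                    / (\<integral>z. (norm (inv_sqrt_mat Qlam *v \<phi> (fst z)))\<^sup>2 \<partial>P) * D / real n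
               + 1000 * (SUP v::real^'d.
                     (\<integral>z. (v \<bullet> \<phi> (fst z))\<^sup>2 * (\<theta>t \<bullet> \<phi> (fst z) - snd z)\<^sup>2 \<partial>P)
                     / ((\<integral>z. (v \<bullet> \<phi> (fst z))\<^sup>2 \<partial>P) + lam * (norm v)\<^sup>2))
                  * ln (3 / \<epsilon>) / real n)
           \<le> ereal (INF \<theta>\<in>\<Theta>. R \<theta> + lam * (norm \<theta>)\<^sup>2)
              + esssup P (\<lambda>z. enn2ereal (nn_cond_exp P (vimage_algebra (space P) fst MX)
                               (\<lambda>w. ennreal ((snd w - \<theta>t \<bullet> \<phi> (fst w))\<^sup>2)) z))
                * ereal ((30 * D + 1000 * ln (3 / \<epsilon>)) / real n)))"
    (is "\<forall>\<epsilon>>0. ?goal \<epsilon>")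
proof (intro allI impI)
  fix \<epsilon> :: real assume \<epsilon>0: "0 < \<epsilon>"
  define \<Phi> :: "'x \<times> real \<Rightarrow> real^'d" where "\<Phi> z = \<phi> (fst z)" for z
  define \<eta> :: "'x \<times> real \<Rightarrow> real" where "\<eta> z = \<theta>t \<bullet> \<Phi> z - snd z" for z
  interpret P: prob_space P by fact
  have fst_meas: "fst \<in> P \<rightarrow>\<^sub>M MX" and snd_meas[measurable]: "snd \<in> borel_measurable P"
    using sets_P by (simp_all cong: measurable_cong_sets)
  have \<Phi>_meas[measurable]: "\<Phi> \<in> borel_measurable P"
    unfolding \<Phi>_def[abs_def] using measurable_compose[OF fst_meas \<phi>_meas] .
  have \<eta>_meas[measurable]: "\<eta> \<in> borel_measurable P" by (simp add: \<eta>_def[abs_def])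
  have \<Phi>2: "integrable P (\<lambda>z. (norm (\<Phi> z))\<^sup>2)"
  proof -
    have "integrable P (\<lambda>z. \<Sum>j\<in>UNIV. (\<phi> (fst z) $ j)\<^sup>2)"
      by (rule Bochner_Integration.integrable_sum) (rule \<phi>_sq)
    then show ?thesis
      unfolding \<Phi>_def norm_square_eq_sum_axis by (simp add: inner_axis')
  qed
  have \<eta>2: "integrable P (\<lambda>z. (\<eta> z)\<^sup>2)"
  proof (rule Bochner_Integration.integrable_bound)
    show "integrable P (\<lambda>z. 2 * ((norm \<theta>t)\<^sup>2 * (norm (\<Phi> z))\<^sup>2) + 2 * (snd z)\<^sup>2)"
      using \<Phi>2 Y_sq by simp
    have "(\<eta> z)\<^sup>2 \<le> 2 * ((norm \<theta>t)\<^sup>2 * (norm (\<Phi> z))\<^sup>2) + 2 * (snd z)\<^sup>2" for z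
    proof -
      have "(\<eta> z)\<^sup>2 \<le> 2 * (\<theta>t \<bullet> \<Phi> z)\<^sup>2 + 2 * (snd z)\<^sup>2"
        using zero_le_power2[of "\<theta>t \<bullet> \<Phi> z + snd z"]
        by (simp add: \<eta>_def power2_eq_square algebra_simps)
      also have "(\<theta>t \<bullet> \<Phi> z)\<^sup>2 \<le> (norm \<theta>t)\<^sup>2 * (norm (\<Phi> z))\<^sup>2"
        using power_mono[OF Cauchy_Schwarz_ineq2[of \<theta>t "\<Phi> z"], of 2] by (simp add: power_mult_distrib)
      finally show ?thesis by simp
    qed
    then show "AE z in P. norm ((\<eta> z)\<^sup>2) \<le> norm (2 * ((norm \<theta>t)\<^sup>2 * (norm (\<Phi> z))\<^sup>2) + 2 * (snd z)\<^sup>2)"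
      by simp
  qed simp
  interpret N: ridge_noise P \<Phi> \<eta> lam
    by unfold_locales
       (use \<Phi>_meas \<eta>_meas \<eta>2 moment4 moment_noise lam_nonneg in \<open>simp_all add: \<Phi>_def \<eta>_def\<close>)
  have Q: "Q = N.Q" by (simp add: Q_def N.Q_def \<Phi>_def)
  have D: "D = N.eff_dim" by (simp add: D_def N.eff_dim_def Q)
  have \<psi>: "inv_sqrt_mat Qlam *v \<phi> (fst z) = N.\<psi> z" for z
    by (simp add: N.\<psi>_def N.T_def Qlam_def Q \<Phi>_def)
  have \<eta>: "\<theta>t \<bullet> \<phi> (fst z) - snd z = \<eta> z" for z by (simp add: \<eta>_def \<Phi>_def)
  have \<eta>': "(snd z - \<theta>t \<bullet> \<phi> (fst z))\<^sup>2 = (\<eta> z)\<^sup>2" for z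
    by (simp add: \<eta>_def \<Phi>_def power2_commute)
  have residual: "\<theta> \<bullet> \<phi> (fst z) - snd z = \<eta> z + (\<theta> - \<theta>t) \<bullet> \<Phi> z" for \<theta> z
    by (simp add: \<eta>_def \<Phi>_def inner_diff_left)
  have R: "R \<theta> = (\<integral>z. (\<eta> z + (\<theta> - \<theta>t) \<bullet> \<Phi> z)\<^sup>2 \<partial>P)" for \<theta>
    unfolding R_def residual[symmetric] by (simp add: power2_commute)
  have r: "r n \<omega> \<theta> = (\<Sum>i<n. (\<eta> (\<omega> i) + (\<theta> - \<theta>t) \<bullet> \<Phi> (\<omega> i))\<^sup>2) / real n" for n \<omega> \<theta>
    by (simp add: r_def residual)
  have trace: "(\<integral>z. (norm (inv_sqrt_mat Qlam *v \<phi> (fst z)))\<^sup>2 * (\<theta>t \<bullet> \<phi> (fst z) - snd z)\<^sup>2 \<partial>P) = N.noise_trace"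
    by (simp add: \<psi> \<eta> N.noise_trace_def)
  have sup: "(SUP v. (\<integral>z. (v \<bullet> \<phi> (fst z))\<^sup>2 * (\<theta>t \<bullet> \<phi> (fst z) - snd z)\<^sup>2 \<partial>P)
      / ((\<integral>z. (v \<bullet> \<phi> (fst z))\<^sup>2 \<partial>P) + lam * (norm v)\<^sup>2)) = N.noise_sup"
    unfolding \<eta> N.noise_sup_def \<Phi>_def ..
  \<comment> \<open>The infimum is attained at \<open>\<theta>t\<close>.\<close>
  have inf: "(INF \<theta>\<in>\<Theta>. R \<theta> + lam * (norm \<theta>)\<^sup>2) = R \<theta>t + lam * (norm \<theta>t)\<^sup>2"
    using \<theta>t_in \<theta>t_min by (intro cInf_eq_minimum) auto
  have simplify: "30 * N.noise_trace / (\<integral>z. (norm (inv_sqrt_mat Qlam *v \<phi> (fst z)))\<^sup>2 \<partial>P) * D / real n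
      = 30 * N.noise_trace / real n" for n
    using arg_cong[OF N.noise_trace_div_mult_eff_dim, of "\<lambda>x. 30 * x / real n"] by (simp add: \<psi> D)
  show "?goal \<epsilon>"
  proof (cases "\<epsilon> < 1")
    \<comment> \<open>For \<open>\<epsilon> >= 1\<close> the empty event already has probability at
      least \<open>1 - \<epsilon>\<close>.\<close>
    case False
    then show ?thesis by (intro exI[of _ 0] allI impI bexI[of _ "{}"]) auto
  next
    case True
    define l where "l = ln (3 / \<epsilon>)"
    have l: "0 < l" using \<epsilon>0 True by (simp add: l_def)
    define K where "K = esssup P (\<lambda>z. enn2ereal (nn_cond_exp P (vimage_algebra (space P) fst MX)
       (\<lambda>w. ennreal ((snd w - \<theta>t \<bullet> \<phi> (fst w))\<^sup>2)) z))"
    have second: "ereal (R \<theta>t + lam * (norm \<theta>t)\<^sup>2 + 30 * N.noise_trace / real n + 1000 * N.noise_sup * l / real n)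
       \<le> ereal (R \<theta>t + lam * (norm \<theta>t)\<^sup>2) + K * ereal ((30 * D + 1000 * l) / real n)" if n: "0 < n" for n :: nat
    proof -
      let ?F = "vimage_algebra (space P) fst MX"
      let ?V = "nn_cond_exp P ?F (\<lambda>w. ennreal ((\<eta> w)\<^sup>2))"
      have K: "K = esssup P (\<lambda>z. enn2ereal (?V z))" by (simp add: K_def \<eta>')
      \<comment> \<open>Since \<open>P\<close> has positive mass, a bound between constants that
        holds almost everywhere simply holds; this gives \<open>K0\<close>.\<close>
      have ae: "AE z in P. enn2ereal (?V z) \<le> K" unfolding K by (rule esssup_AE)
      then have "AE z in P. 0 \<le> K" by eventually_elim (rule order_trans[OF enn2ereal_nonneg])
      then have K0: "0 \<le> K" by simp
      \<comment> \<open>Strict positivity makes an infinite \<open>K\<close> yield an infinite right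
        side instead of a product with 0.\<close>
      have coef: "0 < 30 * D + 1000 * l" using N.eff_dim_nonneg l by (simp add: D)
      show ?thesis
      proof (cases K)
        case (real c)
        then have c: "0 \<le> c" using K0 by simp
        have F: "subalgebra P ?F" "fst \<in> ?F \<rightarrow>\<^sub>M MX"
          using fst_meas measurable_space[OF fst_meas]
          by (auto simp: subalgebra_def measurable_iff_sets intro!: measurable_vimage_algebra1)
        have "AE z in P. ?V z \<le> ennreal c"
          using ae unfolding real by eventually_elim (simp add: less_eq_ennreal.rep_eq enn2ereal_ennreal c)
        note b = N.noise_bounds_of_conditional_variance[OF F(1) _ c this]
        have \<Phi>F: "\<Phi> \<in> borel_measurable ?F"
          unfolding \<Phi>_def[abs_def] using measurable_compose[OF F(2) \<phi>_meas] .
        have "30 * N.noise_trace + 1000 * N.noise_sup * l \<le> 30 * (c * D) + 1000 * c * l"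
          using b[OF \<Phi>F] l by (intro add_mono mult_left_mono mult_right_mono) (auto simp: D N.eff_dim_eq)
        then have "(30 * N.noise_trace + 1000 * N.noise_sup * l) / real n \<le> (30 * (c * D) + 1000 * c * l) / real n"
          by (rule divide_right_mono) simp
        then show ?thesis
          by (simp add: real add_divide_distrib algebra_simps)
      next
        case PInf
        then show ?thesis using coef n by simp
      next
        case MInf
        then show ?thesis using K0 by simp
      qed
    qed
    from N.eventually_good_sample[OF \<epsilon>0 True] obtain N0 where N0: "\<And>n. n \<ge> N0 \<Longrightarrow>
      \<exists>A\<in>sets (PiM {..<n} (\<lambda>_. P)). 1 - \<epsilon> \<le> measure (PiM {..<n} (\<lambda>_. P)) A
        \<and> (\<forall>\<omega>\<in>A. N.good_sample n (15 * N.noise_trace + 500 * N.noise_sup * l) \<omega>)"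
      unfolding l_def eventually_sequentially by blast
    show ?thesis
      unfolding trace sup inf simplify l_def[symmetric] K_def[symmetric]
    \<comment> \<open>The maximum with 1 excludes \<open>n = 0\<close>, where division by
      \<open>real n\<close> would degenerate.\<close>
    proof (intro exI[of _ "max 1 N0"] allI impI)
      fix n assume "max 1 N0 \<le> n"
      then have n: "0 < n" "N0 \<le> n" by auto
      from N0[OF n(2)] obtain A where A: "A \<in> sets (PiM {..<n} (\<lambda>_. P))" "1 - \<epsilon> \<le> measure (PiM {..<n} (\<lambda>_. P)) A"
        and good: "\<And>\<omega>. \<omega> \<in> A \<Longrightarrow> N.good_sample n (15 * N.noise_trace + 500 * N.noise_sup * l) \<omega>" by blast
      \<comment> \<open>The factor 2 in \<open>excess_risk_le\<close> turns 15 and 500 into 30 and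
        1000.\<close>
      have first: "R \<theta>h + lam * (norm \<theta>h)\<^sup>2
          \<le> R \<theta>t + lam * (norm \<theta>t)\<^sup>2 + 30 * N.noise_trace / real n + 1000 * N.noise_sup * l / real n"
        if "\<omega> \<in> A" and h: "\<theta>h \<in> \<Theta>" "\<forall>\<theta>\<in>\<Theta>. r n \<omega> \<theta>h + lam * (norm \<theta>h)\<^sup>2 \<le> r n \<omega> \<theta> + lam * (norm \<theta>)\<^sup>2"
        for \<omega> \<theta>h
        using N.excess_risk_le[OF good[OF \<open>\<omega> \<in> A\<close>] n(1) \<Theta>_convex \<theta>t_in h(1)] h(2)
        by (simp add: R r add_divide_distrib)
      show "\<exists>A \<in> sets (PiM {..<n} (\<lambda>_. P)).
        measure (PiM {..<n} (\<lambda>_. P)) A \<ge> 1 - \<epsilon> \<and> (\<forall>\<omega>\<in>A. \<forall>\<theta>h.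
           (\<theta>h \<in> \<Theta> \<and> (\<forall>\<theta>\<in>\<Theta>. r n \<omega> \<theta>h + lam * (norm \<theta>h)\<^sup>2 \<le> r n \<omega> \<theta> + lam * (norm \<theta>)\<^sup>2)) \<longrightarrow>
           R \<theta>h + lam * (norm \<theta>h)\<^sup>2
             \<le> R \<theta>t + lam * (norm \<theta>t)\<^sup>2 + 30 * N.noise_trace / real n + 1000 * N.noise_sup * l / real n
           \<and> ereal (R \<theta>t + lam * (norm \<theta>t)\<^sup>2 + 30 * N.noise_trace / real n + 1000 * N.noise_sup * l / real n)
             \<le> ereal (R \<theta>t + lam * (norm \<theta>t)\<^sup>2) + K * ereal ((30 * D + 1000 * l) / real n))"
        using A first second[OF n(1)] by (intro bexI[of _ A]) auto
    qed
  qed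
qed

end
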